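(* Let $m \geq 1$ and $n \geq m$ be integers, let $t_1, \ldots, t_n \in [0,1]$ and $Y_1, \ldots, Y_n \in \mathbb{R}$, and let $\lambda > 0$. Let $\rho : \mathbb{R} \to \mathbb{R}$ be such that $\rho(x)$ is a lower semicontinuous, nondecreasing and unbounded function of $|x|$. Then the minimization problem $$\inf_{f \in \mathcal{W}^{m,2}([0,1])} \left[ \frac{1}{n} \sum_{i=1}^n \rho\left(Y_i - f(t_i)\right) + \lambda \|f^{(m)}\|_2^2 \right]$$ has a solution in $\mathcal{W}^{m,2}([0,1])$, i.e. the infimum is attained by some $f \in \mathcal{W}^{m,2}([0,1])$.
   Context: $\mathcal{W}^{m,2}([0,1])$ is the Sobolev space of functions $f:[0,1]\to\mathbb{R}$ such that $f, f^{(1)}, \ldots, f^{(m-1)}$ are absolutely continuous and $\int_0^1 |f^{(m)}(x)|^2\,dx < \infty$. $\|\cdot\|_2$ is the norm of $\mathcal{L}^2([0,1])$. *)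

theory Defs
  imports "HOL-Analysis.Analysis"
begin

text \<open>
  A function on \<open>[0,1]\<close> is represented by a total function \<^typ>\<open>real \<Rightarrow> real\<close>; its values outside
  \<open>[0,1]\<close> play no role in any notion below.
\<close>

definition absolutely_continuous_on :: "real set \<Rightarrow> (real \<Rightarrow> real) \<Rightarrow> bool" where
  "absolutely_continuous_on S f \<longleftrightarrow>
     (\<forall>\<epsilon>>0. \<exists>\<delta>>0. \<forall>I :: (real \<times> real) set.
        finite I \<and>
        (\<forall>(a, b)\<in>I. a < b \<and> {a..b} \<subseteq> S) \<and>
        disjoint_family_on (\<lambda>(a, b). {a<..<b}) I \<and>
        (\<Sum>(a, b)\<in>I. b - a) < \<delta>
        \<longrightarrow> (\<Sum>(a, b)\<in>I. \<bar>f b - f a\<bar>) < \<epsilon>)"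

text \<open>
  The derivative is taken within \<open>[0,1]\<close>, hence one-sided at the endpoints. Where \<open>f\<close> is not
  differentiable, \<^const>\<open>vector_derivative\<close> yields an unspecified value. In the definition of
  \<open>sobolev_W\<close> below, differentiability on all of \<open>[0,1]\<close> is therefore demanded explicitly up to order
  \<open>m - 1\<close>, while the \<open>m\<close>-th derivative exists almost everywhere by absolute continuity of
  the \<open>(m - 1)\<close>-st, so that the unspecified values do not affect its integral.
\<close>

definition nth_deriv :: "nat \<Rightarrow> (real \<Rightarrow> real) \<Rightarrow> real \<Rightarrow> real" where
  "nth_deriv k = ((\<lambda>f x. vector_derivative f (at x within {0..1})) ^^ k)"

definition sobolev_W :: "nat \<Rightarrow> (real \<Rightarrow> real) set" where
  "sobolev_W m =
     {f. (\<forall>k. Suc k < m \<longrightarrow> nth_deriv k f differentiable_on {0..1}) \<and>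
         (\<forall>k<m. absolutely_continuous_on {0..1} (nth_deriv k f)) \<and>
         set_integrable lebesgue {0..1} (\<lambda>x. \<bar>nth_deriv m f x\<bar>\<^sup>2)}"

definition L2_norm :: "(real \<Rightarrow> real) \<Rightarrow> real" where
  "L2_norm f = sqrt (LINT x:{0..1}|lebesgue. \<bar>f x\<bar>\<^sup>2)"

definition lower_semicontinuous_on :: "real set \<Rightarrow> (real \<Rightarrow> real) \<Rightarrow> bool" where
  "lower_semicontinuous_on S g \<longleftrightarrow> (\<forall>x\<in>S. \<forall>c<g x. \<forall>\<^sub>F y in at x within S. c < g y)"

definition penalized_risk ::
    "nat \<Rightarrow> nat \<Rightarrow> (nat \<Rightarrow> real) \<Rightarrow> (nat \<Rightarrow> real) \<Rightarrow> real \<Rightarrow> (real \<Rightarrow> real) \<Rightarrow> (real \<Rightarrow> real) \<Rightarrow> real" where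
  "penalized_risk m n t Y lam \<rho> f =
     1 / real n * (\<Sum>i=1..n. \<rho> (Y i - f (t i))) + lam * (L2_norm (nth_deriv m f))\<^sup>2"

end

theory Submission
  imports Defs "HOL-Analysis.Finite_Function_Topology"
begin

text \<open>
  By Taylor's formula with integral remainder, \<open>f (t i)\<close> is a polynomial in \<open>t i\<close> plus the \<open>L\<^sup>2\<close> inner
  product of the \<open>m\<close>-th derivative of \<open>f\<close> with a truncated power \<open>\<phi> i\<close>. Projecting this derivative
  onto the span of \<open>\<phi> 1, \<dots>, \<phi> n\<close> and integrating back changes no value \<open>f (t i)\<close> and does not increase the
  penalty, so only a finite-dimensional space of splines matters. There, the objective is lower
  semicontinuous, and it is coercive modulo the kernel of the form
  \<open>(\<Sum>i. f (t i) * h (t i)) + \<langle>D f, D h\<rangle>\<close>, where \<open>D\<close> is the \<open>m\<close>-th derivative; it does not depend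
  on that kernel.

  Taylor's formula rests on Lebesgue's theorem that absolutely continuous functions are differentiable
  almost everywhere and are integrals of their derivatives.
\<close>

section \<open>Finite families of intervals and Vitali covers\<close>

text \<open>Since \<open>\<rho>\<close> is only lower semicontinuous in the residual, neither
  convexity nor differentiability of the objective is available, and a minimiser has to come from
  compactness. In finite dimension this is Bolzano-Weierstrass on coordinates, without weak
  topologies on Sobolev spaces. Knots may coincide, so the truncated powers may be linearly
  dependent and the data need not determine the polynomial part; no form in the proof can be assumed
  definite. Both the projection and the minimisation therefore rest on \<open>gram_schmidt\<close>,
  which treats semidefinite forms and expands vectors modulo the kernel. Coefficients are finitely
  supported sequences, one real vector space for all \<open>m\<close> and \<open>n\<close>, and all
  spans are taken there. The derivative of order \<open>m\<close> is a pointwise one that exists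
  almost everywhere; recovering the function from it is where absolute continuity enters. Almost
  everywhere differentiability is obtained from Vitali covers, and the gauge integral gives the
  fundamental theorem together with integrability of the derivative.\<close>

definition interval_family :: "real \<Rightarrow> real \<Rightarrow> (real \<times> real) set \<Rightarrow> bool" where
  "interval_family a b I \<longleftrightarrow>
     finite I \<and> (\<forall>(p, q)\<in>I. a \<le> p \<and> p < q \<and> q \<le> b) \<and>
     disjoint_family_on (\<lambda>(p, q). {p<..<q}) I"

lemma interval_familyD:
  assumes "interval_family a b I"
  shows "finite I" "\<And>p q. (p, q) \<in> I \<Longrightarrow> a \<le> p \<and> p < q \<and> q \<le> b"
    "\<And>p q p' q'. (p, q) \<in> I \<Longrightarrow> (p', q') \<in> I \<Longrightarrow> (p, q) \<noteq> (p', q') \<Longrightarrow> q \<le> p' \<or> q' \<le> p"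
proof -
  show "finite I" "\<And>p q. (p, q) \<in> I \<Longrightarrow> a \<le> p \<and> p < q \<and> q \<le> b"
    using assms by (auto simp: interval_family_def)
  show "q \<le> p' \<or> q' \<le> p" if "(p, q) \<in> I" "(p', q') \<in> I" "(p, q) \<noteq> (p', q')" for p q p' q'
  proof (rule ccontr)
    assume n: "\<not> (q \<le> p' \<or> q' \<le> p)"
    have "p < q" "p' < q'" using assms that by (auto simp: interval_family_def)
    with n have "max p p' < min q q'" by auto
    then obtain z where "max p p' < z" "z < min q q'" using dense by blast
    then have "z \<in> {p<..<q} \<inter> {p'<..<q'}" by auto
    moreover have "{p<..<q} \<inter> {p'<..<q'} = {}"
      using assms that unfolding interval_family_def disjoint_family_on_def by fastforce
    ultimately show False by auto
  qed
qed

lemma interval_familyI: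
  assumes "finite I" "\<And>p q. (p, q) \<in> I \<Longrightarrow> a \<le> p \<and> p < q \<and> q \<le> b"
    "\<And>p q p' q'. (p, q) \<in> I \<Longrightarrow> (p', q') \<in> I \<Longrightarrow> (p, q) \<noteq> (p', q') \<Longrightarrow> q \<le> p' \<or> q' \<le> p"
  shows "interval_family a b I"
proof -
  have "{p<..<q} \<inter> {p'<..<q'} = {}"
    if "(p, q) \<in> I" "(p', q') \<in> I" "(p, q) \<noteq> (p', q')" for p q p' q'
    using assms(3)[OF that] by auto
  then have "disjoint_family_on (\<lambda>(p, q). {p<..<q}) I"
    unfolding disjoint_family_on_def by (simp add: split_paired_all Ball_def)
  then show ?thesis
    unfolding interval_family_def using assms(1,2) by auto
qed

lemma interval_family_subset:
  "interval_family a b I \<Longrightarrow> J \<subseteq> I \<Longrightarrow> interval_family a b J"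
  unfolding interval_family_def by (auto intro: finite_subset disjoint_family_on_mono)

lemma interval_family_mono:
  "interval_family a b I \<Longrightarrow> a' \<le> a \<Longrightarrow> b \<le> b' \<Longrightarrow> interval_family a' b' I"
  unfolding interval_family_def by fastforce

text \<open>The gaps left by the family have nonnegative increments too, so dropping them from a
  telescoping sum only decreases it. The induction splits off the interval with the largest left
  endpoint, because all others end no later than it starts.\<close>

lemma sum_increments_le:
  fixes \<mu> :: "real \<Rightarrow> real"
  assumes "interval_family a b I" "mono_on {a..b} \<mu>" "a \<le> b"
  shows "(\<Sum>(p, q)\<in>I. \<mu> q - \<mu> p) \<le> \<mu> b - \<mu> a"
  using assms
proof (induction "card I" arbitrary: I b)
  case 0
  then have "I = {}" using interval_familyD(1) by fastforce
  with 0 show ?case by (auto simp: mono_on_def)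
next
  case (Suc n)
  note I = interval_familyD[OF Suc.prems(1)]
  have ne: "I \<noteq> {}" using Suc.hyps by auto
  define P where "P = Max (fst ` I)"
  have "P \<in> fst ` I" unfolding P_def using I(1) ne by simp
  then obtain Q where PQ: "(P, Q) \<in> I" by force
  have max: "p \<le> P" if "(p, q) \<in> I" for p q
    unfolding P_def using I(1) that by (force intro: Max_ge)
  define J where "J = I - {(P, Q)}"
  have le: "q \<le> P" if "(p, q) \<in> J" for p q
    using I(3)[of p q P Q] I(2)[of P Q] I(2)[of p q] max[of p q] that PQ unfolding J_def by force
  have J: "interval_family a P J"
    using interval_family_subset[OF Suc.prems(1), of J] le
    by (intro interval_familyI) (auto dest: interval_familyD simp: J_def)
  have "n = card J" using Suc.hyps PQ I(1) by (simp add: J_def)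
  moreover have m: "mono_on {a..P} \<mu>" "a \<le> P"
    using Suc.prems(2) I(2)[OF PQ] by (auto simp: mono_on_def)
  ultimately have *: "(\<Sum>(p, q)\<in>J. \<mu> q - \<mu> p) \<le> \<mu> P - \<mu> a"
    using Suc.hyps(1) J by blast
  have "(\<Sum>(p, q)\<in>I. \<mu> q - \<mu> p) = (\<mu> Q - \<mu> P) + (\<Sum>(p, q)\<in>J. \<mu> q - \<mu> p)"
    using sum.remove[OF I(1) PQ, of "\<lambda>(p, q). \<mu> q - \<mu> p"] by (simp add: J_def)
  also have "\<dots> \<le> \<mu> b - \<mu> a"
    using * mono_onD[OF Suc.prems(2), of Q b] I(2)[OF PQ] Suc.prems(3) by auto
  finally show ?case .
qed

text \<open>The intervals of \<open>J\<close> are grouped by an enclosing interval of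
  \<open>I\<close>, and \<open>sum_increments_le\<close> is applied inside each.\<close>

lemma sum_increments_nested_le:
  fixes \<mu> :: "real \<Rightarrow> real"
  assumes I: "interval_family a b I" and J: "interval_family a b J" and mono: "mono_on {a..b} \<mu>"
    and nest: "\<And>p q. (p, q) \<in> J \<Longrightarrow> \<exists>(u, v)\<in>I. u \<le> p \<and> q \<le> v"
  shows "(\<Sum>(p, q)\<in>J. \<mu> q - \<mu> p) \<le> (\<Sum>(u, v)\<in>I. \<mu> v - \<mu> u)"
proof -
  have "\<forall>j\<in>J. \<exists>i. i \<in> I \<and> fst i \<le> fst j \<and> snd j \<le> snd i"
    using nest by fastforce
  then obtain h where h: "\<And>j. j \<in> J \<Longrightarrow> h j \<in> I \<and> fst (h j) \<le> fst j \<and> snd j \<le> snd (h j)"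
    by metis
  have "(\<Sum>(p, q)\<in>J. \<mu> q - \<mu> p) = (\<Sum>i\<in>I. \<Sum>(p, q)\<in>{j \<in> J. h j = i}. \<mu> q - \<mu> p)"
    by (rule sum.group[symmetric]) (use interval_familyD[OF I] interval_familyD[OF J] h in auto)
  also have "\<dots> \<le> (\<Sum>(u, v)\<in>I. \<mu> v - \<mu> u)"
  proof (rule sum_mono, clarify)
    fix u v assume uv: "(u, v) \<in> I"
    have "interval_family a b {j \<in> J. h j = (u, v)}"
      by (rule interval_family_subset[OF J]) auto
    then have "interval_family u v {j \<in> J. h j = (u, v)}"
      by (intro interval_familyI) (use h in \<open>force dest: interval_familyD\<close>)+
    moreover have "mono_on {u..v} \<mu>" "u \<le> v"
      using mono interval_familyD(2)[OF I uv] by (auto simp: mono_on_def)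
    ultimately show "(\<Sum>(p, q)\<in>{j \<in> J. h j = (u, v)}. \<mu> q - \<mu> p) \<le> \<mu> v - \<mu> u"
      by (rule sum_increments_le)
  qed
  finally show ?thesis .
qed

text \<open>Vitali's theorem extracts from the fine cover a countable disjoint subfamily that misses
  only a null part of \<open>E\<close>, and a bound on finite subfamilies passes to its union. The
  exceptional sets below are estimated this way, by turning bad slopes into short intervals.\<close>

lemma vitali_bound:
  fixes E :: "real set" and K :: "(real \<times> real) set"
  assumes fine: "\<And>x d. x \<in> E \<Longrightarrow> 0 < d \<Longrightarrow> \<exists>(p, q)\<in>K. p \<le> x \<and> x \<le> q \<and> q - p < d"
    and lt: "\<And>p q. (p, q) \<in> K \<Longrightarrow> a \<le> p \<and> p < q \<and> q \<le> b"
    and bound: "\<And>J. J \<subseteq> K \<Longrightarrow> interval_family a b J \<Longrightarrow> (\<And>p q p' q'. (p, q) \<in> J \<Longrightarrow>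
      (p', q') \<in> J \<Longrightarrow> (p, q) \<noteq> (p', q') \<Longrightarrow> {p..q} \<inter> {p'..q'} = {}) \<Longrightarrow> (\<Sum>(p, q)\<in>J. q - p) \<le> B"
  shows "\<exists>T. E \<subseteq> T \<and> T \<in> lmeasurable \<and> measure lebesgue T \<le> B"
proof -
  define c r :: "real \<times> real \<Rightarrow> real" where "c = (\<lambda>(p, q). (p + q) / 2)" and "r = (\<lambda>(p, q). (q - p) / 2)"
  have cb: "cball (c (p, q)) (r (p, q)) = {p..q}" for p q
    by (auto simp: c_def r_def cball_def dist_real_def abs_le_iff field_simps)
  obtain C where C: "countable C" "C \<subseteq> K"
    "pairwise (\<lambda>i j. disjnt (cball (c i) (r i)) (cball (c j) (r j))) C"
    "negligible (E - (\<Union>i\<in>C. cball (c i) (r i)))"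
  proof (rule Vitali_covering_theorem_cballs[of K r E c])
    show "0 < r i" if "i \<in> K" for i using lt that by (cases i) (auto simp: r_def)
    show "\<exists>i. i \<in> K \<and> x \<in> cball (c i) (r i) \<and> r i < d" if x: "x \<in> E" "0 < d" for x d
    proof -
      obtain p q where pq: "(p, q) \<in> K" "p \<le> x" "x \<le> q" "q - p < d" using fine[OF x] by auto
      then have "r (p, q) < d" by (auto simp: r_def)
      with pq show ?thesis using cb[of p q] by (intro exI[of _ "(p, q)"]) auto
    qed
  qed
  define U where "U = (\<Union>i\<in>C. cball (c i) (r i))"
  have fin: "measure lebesgue (\<Union>i\<in>J. cball (c i) (r i)) \<le> B" if J: "J \<subseteq> C" "finite J" for J
  proof -
    have dis: "{p..q} \<inter> {p'..q'} = {}"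
      if "(p, q) \<in> J" "(p', q') \<in> J" "(p, q) \<noteq> (p', q')" for p q p' q'
      using C(3) J(1) that cb unfolding pairwise_def disjnt_def by (metis subsetD)
    have fam: "interval_family a b J"
    proof (rule interval_familyI)
      fix p q p' q' assume *: "(p, q) \<in> J" "(p', q') \<in> J" "(p, q) \<noteq> (p', q')"
      then have "p < q" "p' < q'" using lt J C(2) by blast+
      with dis[OF *] show "q \<le> p' \<or> q' \<le> p"
        by (cases "p \<le> p'") force+
    qed (use J lt C(2) in auto)
    have "measure lebesgue (\<Union>i\<in>J. cball (c i) (r i)) \<le> (\<Sum>i\<in>J. measure lebesgue (cball (c i) (r i)))"
      by (rule measure_UNION_le) (use J in auto)
    also have "\<dots> = (\<Sum>(p, q)\<in>J. q - p)"
      using lt J C(2) by (intro sum.cong) (auto simp: cb less_imp_le)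
    also have "\<dots> \<le> B" using bound[of J] fam dis J C(2) by blast
    finally show ?thesis .
  qed
  have U: "U \<in> lmeasurable" "measure lebesgue U \<le> B"
    unfolding U_def by (rule fmeasurable_UN_bound[OF C(1) _ fin] measure_UN_bound[OF C(1) _ fin]; simp)+
  define N where "N = E - U"
  have N: "N \<in> lmeasurable" "measure lebesgue N = 0"
    using C(4) by (auto simp: N_def U_def negligible_iff_measure)
  have "measure lebesgue (U \<union> N) \<le> B"
    using measure_Un_le[of U lebesgue N] U N by auto
  moreover have "U \<union> N \<in> lmeasurable" using U N by auto
  moreover have "E \<subseteq> U \<union> N" by (auto simp: N_def)
  ultimately show ?thesis by (intro exI[of _ "U \<union> N"]) simp
qed

section \<open>Differentiability almost everywhere\<close>

text \<open>A difference quotient at \<open>x\<close> is the slope of an interval with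
  \<open>x\<close> as an endpoint, whichever side \<open>y\<close> lies on. Slopes attained
  arbitrarily near \<open>x\<close> thus yield the fine covers that \<open>vitali_bound\<close>
  expects.\<close>

lemma frequently_slope_interval:
  fixes f :: "real \<Rightarrow> real"
  assumes "\<exists>\<^sub>F y in at x. P ((f y - f x) / (y - x))" "open U" "x \<in> U" "0 < d"
  shows "\<exists>p q. p < q \<and> p \<le> x \<and> x \<le> q \<and> q - p < d \<and> {p..q} \<subseteq> U \<and> P ((f q - f p) / (q - p))"
proof -
  obtain r where r: "r > 0" "ball x r \<subseteq> U" using assms(2,3) open_contains_ball by blast
  have "\<exists>y. P ((f y - f x) / (y - x)) \<and> y \<noteq> x \<and> dist y x < min r d"
  proof (rule ccontr)
    assume "\<nexists>y. P ((f y - f x) / (y - x)) \<and> y \<noteq> x \<and> dist y x < min r d"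
    then have "\<forall>\<^sub>F y in at x. \<not> P ((f y - f x) / (y - x))"
      unfolding eventually_at using r assms(4) by (intro exI[of _ "min r d"]) auto
    with assms(1) show False by (simp add: frequently_def)
  qed
  then obtain y where y: "P ((f y - f x) / (y - x))" "y \<noteq> x" "dist y x < min r d" by blast
  have sub: "{min x y..max x y} \<subseteq> U"
    using y(3) r(2) by (force simp: dist_real_def subset_iff)
  have "(f (max x y) - f (min x y)) / (max x y - min x y) = (f y - f x) / (y - x)"
    using y(2) by (auto simp: max_def min_def divide_simps) (auto simp: algebra_simps)
  with y sub show ?thesis
    by (intro exI[of _ "min x y"] exI[of _ "max x y"]) (auto simp: dist_real_def)
qed

text \<open>
  Botsko's argument. Let \<open>P\<close> be the positive variation of \<open>f\<close>, so that \<open>P\<close> and \<open>Q = P - f\<close> are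
  monotone, and let \<open>I\<close> be a family whose increments almost exhaust \<open>P b\<close>. Then \<open>Q\<close> grows
  little inside \<open>I\<close>, which leaves little room for negative slopes there, and \<open>P\<close> grows little outside
  \<open>I\<close>, which leaves little room for positive slopes there.
\<close>

lemma negligible_oscillating_slopes:
  fixes f :: "real \<Rightarrow> real"
  assumes bv: "\<And>I. interval_family a b I \<Longrightarrow> (\<Sum>(p, q)\<in>I. f q - f p) \<le> M" and "a \<le> b" and "c > 0"
  shows "negligible {x \<in> {a<..<b}. (\<exists>\<^sub>F y in at x. (f y - f x) / (y - x) < - c) \<and>
                                 (\<exists>\<^sub>F y in at x. (f y - f x) / (y - x) > c)}" (is "negligible ?E")
proof -
  define S where "S x = (\<lambda>I. \<Sum>(p, q)\<in>I. f q - f p) ` {I. interval_family a x I}" for x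
  define P where "P x = Sup (S x)" for x
  define Q where "Q x = P x - f x" for x
  have empty: "interval_family a x {}" for x by (auto simp: interval_family_def disjoint_family_on_def)
  have ne: "S x \<noteq> {}" for x using empty by (auto simp: S_def)
  have bdd: "bdd_above (S x)" if "x \<le> b" for x
    unfolding S_def by (intro bdd_aboveI2[of _ _ M] bv) (use that in \<open>auto intro: interval_family_mono\<close>)
  have Pa: "P a = 0"
  proof -
    have "I = {}" if "interval_family a a I" for I using interval_familyD[OF that] by fastforce
    then have "{I. interval_family a a I} = {{}}" using empty by auto
    then show ?thesis by (simp add: P_def S_def)
  qed
  \<comment> \<open>A family on \<open>[a, x]\<close> can be extended by the pair
    \<open>(x, y)\<close> or left as it is; the maximum with 0 records both. It makes
    \<open>P\<close> and \<open>P - f\<close> monotone at once.\<close>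
  have step: "P x + max 0 (f y - f x) \<le> P y" if xy: "a \<le> x" "x < y" "y \<le> b" for x y
  proof -
    have "s \<le> P y - max 0 (f y - f x)" if s: "s \<in> S x" for s
    proof -
      obtain I where I: "interval_family a x I" "s = (\<Sum>(p, q)\<in>I. f q - f p)"
        using s by (auto simp: S_def)
      note D = interval_familyD[OF I(1)]
      have nin: "(x, y) \<notin> I" using D(2) xy by fastforce
      have "interval_family a y I" using I(1) xy by (auto intro: interval_family_mono)
      then have 1: "s \<in> S y" using I(2) by (auto simp: S_def)
      have "interval_family a y (insert (x, y) I)"
      proof (rule interval_familyI)
        have "q \<le> x" if "(p, q) \<in> I" for p q using D(2) that by blast
        then show "q \<le> p' \<or> q' \<le> p" if "(p, q) \<in> insert (x, y) I" "(p', q') \<in> insert (x, y) I"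
          "(p, q) \<noteq> (p', q')" for p q p' q'
          using D(3) that by (metis insertE prod.inject)
        show "a \<le> p \<and> p < q \<and> q \<le> y" if "(p, q) \<in> insert (x, y) I" for p q
          using D(2)[of p q] that xy by auto
      qed (use D(1) in simp)
      then have "(\<Sum>(p, q)\<in>insert (x, y) I. f q - f p) \<in> S y" by (auto simp: S_def)
      then have "s + (f y - f x) \<in> S y" using nin D(1) I(2) by (simp add: add.commute)
      with 1 show ?thesis unfolding P_def using cSup_upper[OF _ bdd[OF xy(3)]] by (smt (verit))
    qed
    then have "P x \<le> P y - max 0 (f y - f x)" unfolding P_def[of x] by (rule cSup_least[OF ne])
    then show ?thesis by simp
  qed
  have monoP: "mono_on {a..b} P" and monoQ: "mono_on {a..b} Q"
  proof -
    have "P x \<le> P y \<and> Q x \<le> Q y" if "a \<le> x" "x \<le> y" "y \<le> b" for x y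
      using step[of x y] that by (cases "x = y") (auto simp: Q_def)
    then show "mono_on {a..b} P" "mono_on {a..b} Q" by (auto simp: mono_on_def)
  qed
  show ?thesis
    unfolding negligible_outer_le
  proof (intro allI impI)
    fix \<epsilon> :: real assume "\<epsilon> > 0"
    \<comment> \<open>Each of the two covers costs \<open>\<eta> / c\<close>, which makes
      \<open>\<epsilon>\<close> in total.\<close>
    define \<eta> where "\<eta> = \<epsilon> * c / 2"
    have "\<eta> > 0" using \<open>\<epsilon> > 0\<close> \<open>c > 0\<close> by (simp add: \<eta>_def)
    then obtain I where I: "interval_family a b I" "P b - \<eta> < (\<Sum>(p, q)\<in>I. f q - f p)"
      using less_cSup_iff[OF ne bdd, of b "P b - \<eta>"] by (auto simp: P_def S_def)
    note ID = interval_familyD[OF I(1)]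
    have PI: "(\<Sum>(p, q)\<in>I. f q - f p) \<le> (\<Sum>(p, q)\<in>I. P q - P p)"
      by (rule sum_mono) (use step ID(2) in \<open>fastforce simp: case_prod_beta\<close>)
    have "(\<Sum>(p, q)\<in>I. Q q - Q p) = (\<Sum>(p, q)\<in>I. P q - P p) - (\<Sum>(p, q)\<in>I. f q - f p)"
      unfolding sum_subtractf[symmetric] by (rule sum.cong) (auto simp: Q_def)
    also have "\<dots> \<le> \<eta>"
      using sum_increments_le[OF I(1) monoP \<open>a \<le> b\<close>] Pa I(2) by simp
    finally have QI: "(\<Sum>(p, q)\<in>I. Q q - Q p) \<le> \<eta>" .
    define K1 where "K1 = {(p, q). p < q \<and> (\<exists>(u, v)\<in>I. u \<le> p \<and> q \<le> v) \<and> f q - f p < - c * (q - p)}"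
    define K2 where "K2 = {(p, q). a \<le> p \<and> p < q \<and> q \<le> b \<and> (\<forall>(u, v)\<in>I. {p..q} \<inter> {u..v} = {}) \<and>
      f q - f p > c * (q - p)}"
    define U1 where "U1 = (\<Union>(u, v)\<in>I. {u<..<v})"
    define U2 where "U2 = {a<..<b} - (\<Union>(u, v)\<in>I. {u..v})"
    have "\<exists>T. ?E \<inter> U1 \<subseteq> T \<and> T \<in> lmeasurable \<and> measure lebesgue T \<le> \<eta> / c"
    proof (rule vitali_bound[where K = K1 and a = a and b = b])
      fix x d :: real assume x: "x \<in> ?E \<inter> U1" and "0 < d"
      then obtain u v where uv: "(u, v) \<in> I" "x \<in> {u<..<v}" by (auto simp: U1_def)
      have "\<exists>\<^sub>F y in at x. (f y - f x) / (y - x) < - c" using x by blast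
      from frequently_slope_interval[where P = "\<lambda>s. s < - c", OF this _ uv(2) \<open>0 < d\<close>] obtain p q where
        *: "p < q" "p \<le> x" "x \<le> q" "q - p < d" "{p..q} \<subseteq> {u<..<v}" "(f q - f p) / (q - p) < - c" by auto
      have "p \<in> {p..q}" "q \<in> {p..q}" using *(1) by auto
      then have "p \<in> {u<..<v}" "q \<in> {u<..<v}" using *(5) by blast+
      then have "(p, q) \<in> K1"
        using uv(1) * by (auto simp: K1_def field_simps intro!: bexI[of _ "(u, v)"])
      then show "\<exists>(p, q)\<in>K1. p \<le> x \<and> x \<le> q \<and> q - p < d" using * by (intro bexI[of _ "(p, q)"]) auto
    next
      show "a \<le> p \<and> p < q \<and> q \<le> b" if "(p, q) \<in> K1" for p q
        using that ID(2) unfolding K1_def by fastforce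
      show "(\<Sum>(p, q)\<in>J. q - p) \<le> \<eta> / c" if J: "J \<subseteq> K1" "interval_family a b J" for J
      proof -
        \<comment> \<open>Here \<open>f\<close> falls by at least \<open>c * (q - p)\<close> while
          \<open>P\<close> does not fall, so \<open>Q\<close> has to rise by as much.\<close>
        have "c * (\<Sum>(p, q)\<in>J. q - p) \<le> (\<Sum>(p, q)\<in>J. Q q - Q p)"
          unfolding sum_distrib_left
        proof (rule sum_mono, clarify)
          fix p q assume "(p, q) \<in> J"
          then have "a \<le> p" "p < q" "q \<le> b" "f q - f p < - c * (q - p)"
            using J interval_familyD(2)[OF J(2)] by (auto simp: K1_def)
          then show "c * (q - p) \<le> Q q - Q p" using step[of p q] by (simp add: Q_def)
        qed
        also have "\<dots> \<le> (\<Sum>(p, q)\<in>I. Q q - Q p)"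
          by (rule sum_increments_nested_le[OF I(1) J(2) monoQ]) (use J(1) in \<open>auto simp: K1_def\<close>)
        also note QI
        finally show ?thesis using \<open>c > 0\<close> by (simp add: field_simps)
      qed
    qed
    then obtain T1 where T1: "?E \<inter> U1 \<subseteq> T1" "T1 \<in> lmeasurable" "measure lebesgue T1 \<le> \<eta> / c" by blast
    have "open U2" unfolding U2_def using ID(1) by (intro open_Diff closed_UN) auto
    have "\<exists>T. ?E \<inter> U2 \<subseteq> T \<and> T \<in> lmeasurable \<and> measure lebesgue T \<le> \<eta> / c"
    proof (rule vitali_bound[where K = K2 and a = a and b = b])
      fix x d :: real assume x: "x \<in> ?E \<inter> U2" and "0 < d"
      have "\<exists>\<^sub>F y in at x. (f y - f x) / (y - x) > c" "x \<in> U2" using x by blast+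
      from frequently_slope_interval[where P = "\<lambda>s. s > c", OF this(1) \<open>open U2\<close> this(2) \<open>0 < d\<close>]
      obtain p q where *: "p < q" "p \<le> x" "x \<le> q" "q - p < d" "{p..q} \<subseteq> U2" "(f q - f p) / (q - p) > c" by auto
      have "p \<in> {p..q}" "q \<in> {p..q}" using *(1) by auto
      then have "p \<in> U2" "q \<in> U2" using *(5) by blast+
      then have "a \<le> p" "q \<le> b" by (auto simp: U2_def)
      have "\<forall>(u, v)\<in>I. {p..q} \<inter> {u..v} = {}" using *(5) unfolding U2_def by blast
      moreover have "f q - f p > c * (q - p)" using *(1,6) by (simp add: field_simps)
      ultimately have "(p, q) \<in> K2" using *(1) \<open>a \<le> p\<close> \<open>q \<le> b\<close> by (simp add: K2_def)
      then show "\<exists>(p, q)\<in>K2. p \<le> x \<and> x \<le> q \<and> q - p < d" using * by (intro bexI[of _ "(p, q)"]) auto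
    next
      show "a \<le> p \<and> p < q \<and> q \<le> b" if "(p, q) \<in> K2" for p q
        using that unfolding K2_def by auto
      show "(\<Sum>(p, q)\<in>J. q - p) \<le> \<eta> / c" if J: "J \<subseteq> K2" "interval_family a b J" for J
      proof -
        note JD = interval_familyD[OF J(2)]
        have sep: "q \<le> u \<or> v \<le> p" "(p, q) \<noteq> (u, v)" if "(p, q) \<in> J" "(u, v) \<in> I" for p q u v
        proof -
          have "{p..q} \<inter> {u..v} = {}" "p < q" "u < v" using that J(1) ID(2) by (auto simp: K2_def)
          moreover from this have "max p u \<in> {p..q} \<inter> {u..v}" if "\<not> (q \<le> u \<or> v \<le> p)" using that by auto
          ultimately show "q \<le> u \<or> v \<le> p" "(p, q) \<noteq> (u, v)" by auto
        qed
        \<comment> \<open>\<open>K2\<close> avoids the closed intervals of \<open>I\<close>, so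
          \<open>I\<close> and \<open>J\<close> form one family and share the total growth
          \<open>P b\<close>; \<open>I\<close> already uses up all of it but
          \<open>\<eta>\<close>.\<close>
        have "interval_family a b (I \<union> J)"
          by (rule interval_familyI) (use ID JD sep in blast)+
        from sum_increments_le[OF this monoP \<open>a \<le> b\<close>]
        have le: "(\<Sum>(p, q)\<in>I. P q - P p) + (\<Sum>(p, q)\<in>J. P q - P p) \<le> P b"
          using ID(1) JD(1) sep(2) Pa by (subst (asm) sum.union_disjoint) auto
        have "c * (\<Sum>(p, q)\<in>J. q - p) \<le> (\<Sum>(p, q)\<in>J. P q - P p)"
          unfolding sum_distrib_left
        proof (rule sum_mono, clarify)
          fix p q assume "(p, q) \<in> J"
          then have "a \<le> p" "p < q" "q \<le> b" "f q - f p > c * (q - p)"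
            using J JD(2) by (auto simp: K2_def)
          then show "c * (q - p) \<le> P q - P p" using step[of p q] by simp
        qed
        also have "\<dots> \<le> \<eta>" using le PI I(2) by simp
        finally show ?thesis using \<open>c > 0\<close> by (simp add: field_simps)
      qed
    qed
    then obtain T2 where T2: "?E \<inter> U2 \<subseteq> T2" "T2 \<in> lmeasurable" "measure lebesgue T2 \<le> \<eta> / c" by blast
    define F where "F = fst ` I \<union> snd ` I"
    have F: "F \<in> lmeasurable" "measure lebesgue F = 0"
      using negligible_finite[of F] ID(1) by (auto simp: F_def negligible_iff_measure)
    have "?E \<subseteq> T1 \<union> T2 \<union> F"
    proof
      fix x assume x: "x \<in> ?E"
      show "x \<in> T1 \<union> T2 \<union> F"
      proof (cases "x \<in> U1 \<union> U2")
        case True then show ?thesis using T1(1) T2(1) x by blast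
      next
        case False
        then obtain u v where "(u, v) \<in> I" "x \<in> {u..v}" "x \<notin> {u<..<v}"
          using x unfolding U1_def U2_def by blast
        then have "x = u \<or> x = v" by auto
        then show ?thesis using \<open>(u, v) \<in> I\<close> by (force simp: F_def)
      qed
    qed
    moreover have "T1 \<union> T2 \<union> F \<in> lmeasurable" using T1 T2 F by auto
    moreover have "measure lebesgue (T1 \<union> T2 \<union> F) \<le> \<epsilon>"
    proof -
      have "measure lebesgue (T1 \<union> T2 \<union> F) \<le> measure lebesgue T1 + measure lebesgue T2 + measure lebesgue F"
        using measure_Un_le[of "T1 \<union> T2" lebesgue F] measure_Un_le[of T1 lebesgue T2] T1 T2 F by auto
      also have "\<dots> \<le> \<eta> / c + \<eta> / c" using T1 T2 F by simp
      also have "\<dots> = \<epsilon>" using \<open>c > 0\<close> by (simp add: \<eta>_def)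
      finally show ?thesis .
    qed
    ultimately show "\<exists>T. ?E \<subseteq> T \<and> T \<in> lmeasurable \<and> measure lebesgue T \<le> \<epsilon>" by blast
  qed
qed

text \<open>Disjoint intervals of slope beyond \<open>L\<close> have total length at most
  \<open>M / L\<close>, and \<open>L\<close> may be as large as desired.\<close>

lemma negligible_unbounded_slopes:
  fixes f :: "real \<Rightarrow> real"
  assumes bv: "\<And>I. interval_family a b I \<Longrightarrow> (\<Sum>(p, q)\<in>I. \<bar>f q - f p\<bar>) \<le> M"
  shows "negligible {x \<in> {a<..<b}. \<forall>K. \<exists>\<^sub>F y in at x. \<bar>(f y - f x) / (y - x)\<bar> > K}" (is "negligible ?E")
  unfolding negligible_outer_le
proof (intro allI impI)
  fix \<epsilon> :: real assume "\<epsilon> > 0"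
  have "M \<ge> 0" using bv[of "{}"] by (auto simp: interval_family_def disjoint_family_on_def)
  \<comment> \<open>The summand 1 keeps \<open>L\<close> positive when \<open>M = 0\<close>.\<close>
  define L where "L = (M + 1) / \<epsilon>"
  have L: "L > 0" "M \<le> \<epsilon> * L" using \<open>\<epsilon> > 0\<close> \<open>M \<ge> 0\<close> by (auto simp: L_def)
  define K where "K = {(p, q). a \<le> p \<and> p < q \<and> q \<le> b \<and> \<bar>f q - f p\<bar> \<ge> L * (q - p)}"
  show "\<exists>T. ?E \<subseteq> T \<and> T \<in> lmeasurable \<and> measure lebesgue T \<le> \<epsilon>"
  proof (rule vitali_bound[where K = K and a = a and b = b])
    fix x d :: real assume x: "x \<in> ?E" and "0 < d"
    have "\<exists>\<^sub>F y in at x. \<bar>(f y - f x) / (y - x)\<bar> > L" "x \<in> {a<..<b}" using x by blast+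
    from frequently_slope_interval[where P = "\<lambda>s. \<bar>s\<bar> > L", OF this(1) _ this(2) \<open>0 < d\<close>]
    obtain p q where *: "p < q" "p \<le> x" "x \<le> q" "q - p < d" "{p..q} \<subseteq> {a<..<b}" "\<bar>(f q - f p) / (q - p)\<bar> > L"
      by auto
    then have "\<bar>f q - f p\<bar> \<ge> L * (q - p)" by (simp add: abs_divide field_simps)
    moreover have "p \<in> {p..q}" "q \<in> {p..q}" using *(1) by auto
    then have "p \<in> {a<..<b}" "q \<in> {a<..<b}" using *(5) by blast+
    then have "a \<le> p" "q \<le> b" by auto
    ultimately show "\<exists>(p, q)\<in>K. p \<le> x \<and> x \<le> q \<and> q - p < d"
      using * by (intro bexI[of _ "(p, q)"]) (auto simp: K_def)
  next
    show "a \<le> p \<and> p < q \<and> q \<le> b" if "(p, q) \<in> K" for p q using that by (auto simp: K_def)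
    show "(\<Sum>(p, q)\<in>J. q - p) \<le> \<epsilon>" if J: "J \<subseteq> K" "interval_family a b J" for J
    proof -
      have "L * (\<Sum>(p, q)\<in>J. q - p) \<le> (\<Sum>(p, q)\<in>J. \<bar>f q - f p\<bar>)"
        unfolding sum_distrib_left by (rule sum_mono) (use J in \<open>auto simp: K_def\<close>)
      also have "\<dots> \<le> \<epsilon> * L" using bv[OF J(2)] L by simp
      finally show ?thesis using L by (simp add: mult.commute)
    qed
  qed
qed

text \<open>A gap between limes inferior and limes superior contains rationals \<open>p < q\<close>
  such that \<open>s\<close> keeps falling below \<open>p\<close> and rising above \<open>q\<close>.
  Rational thresholds leave only countably many exceptional sets in
  \<open>negligible_not_differentiable\<close>.\<close>

lemma bounded_nonoscillating_tendsto:
  fixes s :: "real \<Rightarrow> real"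
  assumes F: "F \<noteq> bot" and bdd: "\<not> (\<exists>\<^sub>F y in F. \<bar>s y\<bar> > K)"
    and osc: "\<And>p q. p \<in> \<rat> \<Longrightarrow> q \<in> \<rat> \<Longrightarrow> p < q \<Longrightarrow> \<not> ((\<exists>\<^sub>F y in F. s y < p) \<and> (\<exists>\<^sub>F y in F. s y > q))"
  shows "\<exists>l. (s \<longlongrightarrow> l) F"
proof -
  define A B where "A = Liminf F (\<lambda>y. ereal (s y))" and "B = Limsup F (\<lambda>y. ereal (s y))"
  have ev: "\<forall>\<^sub>F y in F. \<bar>s y\<bar> \<le> K" using bdd by (simp add: frequently_def not_less)
  have 1: "A \<le> B" unfolding A_def B_def by (rule Liminf_le_Limsup[OF F])
  have 2: "\<not> A < B"
  proof
    assume "A < B"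
    then obtain z1 where "A < ereal z1" "ereal z1 < B" using ereal_dense2 by blast
    then obtain z2 where "ereal z1 < ereal z2" "ereal z2 < B" using ereal_dense2 by blast
    then obtain p where p: "p \<in> \<rat>" "z1 < p" "p < z2" using Rats_dense_in_real by auto
    then obtain q where q: "q \<in> \<rat>" "p < q" "q < z2" using Rats_dense_in_real by blast
    have "\<exists>\<^sub>F y in F. s y < p"
    proof (rule ccontr)
      assume "\<not> (\<exists>\<^sub>F y in F. s y < p)"
      then have "ereal p \<le> A" unfolding A_def frequently_def by (intro Liminf_bounded) (simp add: not_less)
      with \<open>A < ereal z1\<close> p show False by (metis less_ereal.simps(1) less_le_trans not_less_iff_gr_or_eq)
    qed
    moreover have "\<exists>\<^sub>F y in F. s y > q"
    proof (rule ccontr)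
      assume "\<not> (\<exists>\<^sub>F y in F. s y > q)"
      then have "B \<le> ereal q" unfolding B_def frequently_def by (intro Limsup_bounded) (simp add: not_less)
      with \<open>ereal z2 < B\<close> q show False by (metis less_ereal.simps(1) less_le_trans not_less_iff_gr_or_eq)
    qed
    ultimately show False using osc[OF p(1) q(1,2)] by blast
  qed
  have lim: "((\<lambda>y. ereal (s y)) \<longlongrightarrow> A) F"
    using Liminf_eq_Limsup[OF F] 1 2 A_def B_def by (metis order_le_imp_less_or_eq)
  have "ereal (- K) \<le> A" unfolding A_def by (rule Liminf_bounded) (use ev in \<open>auto elim: eventually_mono\<close>)
  moreover have "B \<le> ereal K" unfolding B_def by (rule Limsup_bounded) (use ev in \<open>auto elim: eventually_mono\<close>)
  ultimately obtain l where "A = ereal l" using 1 by (cases A) auto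
  with lim show ?thesis by auto
qed

lemma negligible_not_differentiable:
  fixes f :: "real \<Rightarrow> real"
  assumes bv: "\<And>I. interval_family a b I \<Longrightarrow> (\<Sum>(p, q)\<in>I. \<bar>f q - f p\<bar>) \<le> M" and "a \<le> b"
  shows "negligible {x \<in> {a<..<b}. \<not> f differentiable at x}"
proof -
  define slope where "slope x y = (f y - f x) / (y - x)" for x y
  define V where "V = {x \<in> {a<..<b}. \<forall>K. \<exists>\<^sub>F y in at x. \<bar>slope x y\<bar> > K}"
  define W where "W = (\<lambda>(p, q). {x \<in> {a<..<b}. (\<exists>\<^sub>F y in at x. slope x y < p) \<and> (\<exists>\<^sub>F y in at x. slope x y > q)})"
  have V: "negligible V" unfolding V_def slope_def by (rule negligible_unbounded_slopes[OF bv])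
  have W: "negligible (W (p, q))" if "p < q" for p q
  proof -
    \<comment> \<open>Subtracting a line whose slope \<open>s\<close> is the midpoint of
      \<open>p\<close> and \<open>q\<close> moves the thresholds to the symmetric pair
      \<open>- c\<close> and \<open>c\<close> that \<open>negligible_oscillating_slopes\<close>
      treats.\<close>
    define s c where "s = (p + q) / 2" and "c = (q - p) / 2"
    have pq: "p = s - c" "q = s + c" by (auto simp: s_def c_def field_simps)
    have "c > 0" using that by (simp add: c_def)
    define g where "g x = f x - s * x" for x
    have g: "(g y - g x) / (y - x) = slope x y - s" if "y \<noteq> x" for x y
      using that by (simp add: g_def slope_def field_simps)
    have freq: "(\<exists>\<^sub>F y in at x. R (slope x y - s)) = (\<exists>\<^sub>F y in at x. R ((g y - g x) / (y - x)))" for R x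
    proof -
      have "(\<forall>\<^sub>F y in at x. \<not> R (slope x y - s)) = (\<forall>\<^sub>F y in at x. \<not> R ((g y - g x) / (y - x)))"
        by (rule eventually_cong) (auto simp: eventually_at_filter g)
      then show ?thesis by (simp add: frequently_def)
    qed
    have "negligible {x \<in> {a<..<b}. (\<exists>\<^sub>F y in at x. (g y - g x) / (y - x) < - c) \<and>
                                 (\<exists>\<^sub>F y in at x. (g y - g x) / (y - x) > c)}"
    \<comment> \<open>The subtracted line adds at most \<open>\<bar>s\<bar>\<close> times the total
      length of the family, which is at most \<open>b - a\<close>.\<close>
    proof (rule negligible_oscillating_slopes[where M = "M + \<bar>s\<bar> * (b - a)"])
      fix I assume I: "interval_family a b I"
      have "(\<Sum>(p, q)\<in>I. g q - g p) \<le> (\<Sum>(p, q)\<in>I. \<bar>f q - f p\<bar> + \<bar>s\<bar> * (q - p))"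
      proof (rule sum_mono, clarify)
        fix p q assume "(p, q) \<in> I"
        then have "p < q" using interval_familyD(2)[OF I] by auto
        then have "- s * (q - p) \<le> \<bar>s\<bar> * (q - p)" by (intro mult_right_mono) auto
        then show "g q - g p \<le> \<bar>f q - f p\<bar> + \<bar>s\<bar> * (q - p)" by (simp add: g_def algebra_simps)
      qed
      also have "\<dots> = (\<Sum>(p, q)\<in>I. \<bar>f q - f p\<bar>) + \<bar>s\<bar> * (\<Sum>(p, q)\<in>I. q - p)"
        by (simp add: case_prod_beta sum.distrib sum_distrib_left)
      also have "\<dots> \<le> M + \<bar>s\<bar> * (b - a)"
        using bv[OF I] sum_increments_le[OF I, of "\<lambda>x. x"] \<open>a \<le> b\<close>
        by (intro add_mono mult_left_mono) (auto simp: mono_on_def)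
      finally show "(\<Sum>(p, q)\<in>I. g q - g p) \<le> M + \<bar>s\<bar> * (b - a)" .
    qed fact+
    then show ?thesis
      unfolding W_def pq using freq[where R = "\<lambda>r. r < - c"] freq[where R = "\<lambda>r. r > c"]
      by (simp add: algebra_simps)
  qed
  have "negligible (V \<union> (\<Union>z\<in>{(p, q). p \<in> \<rat> \<and> q \<in> \<rat> \<and> p < q}. W z))"
  proof (intro negligible_Un V negligible_countable_Union)
    have "countable (\<rat> \<times> \<rat> :: (real \<times> real) set)" using countable_rat by auto
    then show "countable (W ` {(p, q). p \<in> \<rat> \<and> q \<in> \<rat> \<and> p < q})"
      by (intro countable_image) (auto elim: countable_subset[rotated])
  qed (use W in auto)
  moreover have "{x \<in> {a<..<b}. \<not> f differentiable at x} \<subseteq> V \<union> (\<Union>z\<in>{(p, q). p \<in> \<rat> \<and> q \<in> \<rat> \<and> p < q}. W z)"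
  proof clarify
    fix x assume x: "x \<in> {a<..<b}" "\<not> f differentiable at x" and nW: "x \<notin> (\<Union>z\<in>{(p, q). p \<in> \<rat> \<and> q \<in> \<rat> \<and> p < q}. W z)"
    show "x \<in> V"
    proof (rule ccontr)
      assume "x \<notin> V"
      then obtain K where "\<not> (\<exists>\<^sub>F y in at x. \<bar>slope x y\<bar> > K)" using x by (auto simp: V_def)
      then have "\<exists>l. (slope x \<longlongrightarrow> l) (at x)"
        by (rule bounded_nonoscillating_tendsto[rotated]) (use nW x in \<open>auto simp: W_def\<close>)
      then obtain l where "(slope x \<longlongrightarrow> l) (at x)" by blast
      then have "(f has_field_derivative l) (at x)" by (simp add: has_field_derivative_iff slope_def[abs_def])
      then show False using x(2) by (auto simp: has_field_derivative_def differentiable_def)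
    qed
  qed
  ultimately show ?thesis by (rule negligible_subset)
qed

section \<open>Absolutely continuous functions\<close>

lemma absolutely_continuous_on_Icc_iff:
  "absolutely_continuous_on {a..b} f \<longleftrightarrow>
    (\<forall>\<epsilon>>0. \<exists>\<delta>>0. \<forall>I. interval_family a b I \<longrightarrow> (\<Sum>(p, q)\<in>I. q - p) < \<delta> \<longrightarrow>
      (\<Sum>(p, q)\<in>I. \<bar>f q - f p\<bar>) < \<epsilon>)"
proof -
  have "(\<forall>(p, q)\<in>I. p < q \<and> {p..q} \<subseteq> {a..b}) \<longleftrightarrow> (\<forall>(p, q)\<in>I. a \<le> p \<and> p < q \<and> q \<le> b)" for I
    by (rule ball_cong) auto
  then show ?thesis
    unfolding absolutely_continuous_on_def interval_family_def by (simp only: imp_conjL)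
qed

lemma absolutely_continuous_on_subinterval:
  assumes "absolutely_continuous_on {a..b} f" "a \<le> a'" "b' \<le> b"
  shows "absolutely_continuous_on {a'..b'} f"
  using assms(1) interval_family_mono[OF _ assms(2,3)] unfolding absolutely_continuous_on_Icc_iff by meson

text \<open>One epsilon-delta argument from which Lipschitz functions (\<open>n = 0\<close>),
  products (\<open>n = 2\<close>) and finite sums all follow.\<close>

lemma absolutely_continuous_on_dominated:
  fixes n :: nat
  assumes "\<And>i. i < n \<Longrightarrow> absolutely_continuous_on {a..b} (g i)" "C \<ge> 0"
    and dom: "\<And>p q. a \<le> p \<Longrightarrow> p < q \<Longrightarrow> q \<le> b \<Longrightarrow> \<bar>f q - f p\<bar> \<le> C * ((q - p) + (\<Sum>i<n. \<bar>g i q - g i p\<bar>))"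
  shows "absolutely_continuous_on {a..b} f"
  unfolding absolutely_continuous_on_Icc_iff
proof (intro allI impI)
  fix \<epsilon> :: real assume "\<epsilon> > 0"
  \<comment> \<open>Each of the \<open>n + 1\<close> contributions is at most \<open>\<eta>\<close>;
    \<open>C + 1\<close> in place of \<open>C\<close> keeps the denominator positive and the final
    estimate strict.\<close>
  define \<eta> where "\<eta> = \<epsilon> / ((C + 1) * (real n + 1))"
  have \<eta>: "\<eta> > 0" using \<open>\<epsilon> > 0\<close> \<open>C \<ge> 0\<close> by (simp add: \<eta>_def)
  have "\<forall>i<n. \<exists>\<delta>>0. \<forall>I. interval_family a b I \<longrightarrow> (\<Sum>(p, q)\<in>I. q - p) < \<delta> \<longrightarrow>
    (\<Sum>(p, q)\<in>I. \<bar>g i q - g i p\<bar>) < \<eta>"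
    using assms(1) \<eta> unfolding absolutely_continuous_on_Icc_iff by blast
  then obtain D where D: "\<forall>i<n. D i > 0 \<and> (\<forall>I. interval_family a b I \<longrightarrow> (\<Sum>(p, q)\<in>I. q - p) < D i \<longrightarrow>
    (\<Sum>(p, q)\<in>I. \<bar>g i q - g i p\<bar>) < \<eta>)"
    by metis
  define \<delta> where "\<delta> = Min (insert \<eta> (D ` {..<n}))"
  have \<delta>: "\<delta> > 0" "\<delta> \<le> \<eta>" "\<And>i. i < n \<Longrightarrow> \<delta> \<le> D i" using \<eta> D by (auto simp: \<delta>_def)
  have "(\<Sum>(p, q)\<in>I. \<bar>f q - f p\<bar>) < \<epsilon>" if I: "interval_family a b I" "(\<Sum>(p, q)\<in>I. q - p) < \<delta>" for I
  proof -
    have "(\<Sum>(p, q)\<in>I. \<bar>f q - f p\<bar>) \<le> (\<Sum>(p, q)\<in>I. C * ((q - p) + (\<Sum>i<n. \<bar>g i q - g i p\<bar>)))"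
      by (rule sum_mono) (use interval_familyD(2)[OF I(1)] dom in auto)
    also have "\<dots> = C * ((\<Sum>(p, q)\<in>I. q - p) + (\<Sum>i<n. \<Sum>(p, q)\<in>I. \<bar>g i q - g i p\<bar>))"
      by (simp add: case_prod_beta sum_distrib_left[symmetric] sum.distrib sum.swap[of _ "{..<n}" I])
    also have "\<dots> \<le> C * (\<eta> + (\<Sum>i<n. \<eta>))"
    proof (intro mult_left_mono add_mono sum_mono)
      show "(\<Sum>(p, q)\<in>I. \<bar>g i q - g i p\<bar>) \<le> \<eta>" if "i \<in> {..<n}" for i
      proof -
        have "(\<Sum>(p, q)\<in>I. q - p) < D i" using I(2) \<delta>(3)[of i] that by simp
        then show ?thesis using D I(1) that by (simp add: less_imp_le)
      qed
    qed (use I \<delta> \<open>C \<ge> 0\<close> in auto)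
    also have "\<dots> = C * (real n + 1) * \<eta>" by (simp add: algebra_simps)
    also have "\<dots> < (C + 1) * (real n + 1) * \<eta>" using \<eta> by simp
    also have "\<dots> = \<epsilon>" using \<open>C \<ge> 0\<close> by (simp add: \<eta>_def)
    finally show ?thesis .
  qed
  with \<delta>(1) show "\<exists>\<delta>>0. \<forall>I. interval_family a b I \<longrightarrow> (\<Sum>(p, q)\<in>I. q - p) < \<delta> \<longrightarrow>
    (\<Sum>(p, q)\<in>I. \<bar>f q - f p\<bar>) < \<epsilon>" by (intro exI[of _ \<delta>]) simp
qed

lemma lipschitz_imp_absolutely_continuous_on:
  assumes "C-lipschitz_on {a..b} f"
  shows "absolutely_continuous_on {a..b} f"
proof (rule absolutely_continuous_on_dominated[where n = 0 and C = C])
  \<comment> \<open>The sum ranges over no index, so \<open>undefined\<close> can stand for the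
    family of functions.\<close>
  show "\<bar>f q - f p\<bar> \<le> C * (q - p + (\<Sum>i<(0::nat). \<bar>undefined i q - undefined i p\<bar>))"
    if "a \<le> p" "p < q" "q \<le> b" for p q
    using lipschitz_onD[OF assms, of q p] that by (simp add: dist_real_def)
qed (use lipschitz_on_nonneg[OF assms] in auto)

lemma absolutely_continuous_on_imp_continuous_on:
  assumes "absolutely_continuous_on {a..b} f"
  shows "continuous_on {a..b} f"
  unfolding continuous_on_iff
proof (intro ballI allI impI)
  fix x \<epsilon> :: real assume x: "x \<in> {a..b}" and "\<epsilon> > 0"
  obtain \<delta> where \<delta>: "\<delta> > 0" "\<forall>I. interval_family a b I \<longrightarrow> (\<Sum>(p, q)\<in>I. q - p) < \<delta> \<longrightarrow>
    (\<Sum>(p, q)\<in>I. \<bar>f q - f p\<bar>) < \<epsilon>"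
    using assms \<open>\<epsilon> > 0\<close> unfolding absolutely_continuous_on_Icc_iff by blast
  have *: "\<bar>f q - f p\<bar> < \<epsilon>" if "a \<le> p" "p < q" "q \<le> b" "q - p < \<delta>" for p q
    using \<delta>(2)[rule_format, of "{(p, q)}"] that by (auto simp: interval_family_def disjoint_family_on_def)
  show "\<exists>d>0. \<forall>x'\<in>{a..b}. dist x' x < d \<longrightarrow> dist (f x') (f x) < \<epsilon>"
  proof (intro exI[of _ \<delta>] conjI \<delta>(1) ballI impI)
    fix y assume "y \<in> {a..b}" "dist y x < \<delta>"
    with x *[of x y] *[of y x] \<open>\<epsilon> > 0\<close> show "dist (f y) (f x) < \<epsilon>"
      by (cases x y rule: linorder_cases) (auto simp: dist_real_def abs_if split: if_splits)
  qed
qed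

lemma absolutely_continuous_on_mult:
  assumes f: "absolutely_continuous_on {a..b} f" and g: "absolutely_continuous_on {a..b} g"
  shows "absolutely_continuous_on {a..b} (\<lambda>x. f x * g x)"
proof -
  have "bounded (f ` {a..b})" "bounded (g ` {a..b})"
    using f g by (auto intro!: compact_imp_bounded compact_continuous_image absolutely_continuous_on_imp_continuous_on)
  then obtain A B where AB: "\<And>x. x \<in> {a..b} \<Longrightarrow> \<bar>f x\<bar> \<le> A" "\<And>x. x \<in> {a..b} \<Longrightarrow> \<bar>g x\<bar> \<le> B"
    unfolding bounded_iff by (metis imageI real_norm_def)
  define h where "h i = (if i = 0 then f else g)" for i :: nat
  show ?thesis
  proof (rule absolutely_continuous_on_dominated[where n = 2 and g = h and C = "max 0 (max A B)"])
    fix p q assume pq: "a \<le> p" "p < q" "q \<le> b"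
    have "f q * g q - f p * g p = (f q - f p) * g q + f p * (g q - g p)" by (simp add: algebra_simps)
    then have "\<bar>f q * g q - f p * g p\<bar> \<le> \<bar>f q - f p\<bar> * \<bar>g q\<bar> + \<bar>f p\<bar> * \<bar>g q - g p\<bar>"
      by (metis abs_mult abs_triangle_ineq)
    also have "\<dots> \<le> \<bar>f q - f p\<bar> * max 0 (max A B) + max 0 (max A B) * \<bar>g q - g p\<bar>"
      using AB(1)[of p] AB(2)[of q] pq by (intro add_mono mult_left_mono mult_right_mono) auto
    also have "\<dots> \<le> max 0 (max A B) * (q - p + (\<Sum>i<2. \<bar>h i q - h i p\<bar>))"
      using mult_nonneg_nonneg[of "max 0 (max A B)" "q - p"] pq by (simp add: h_def numeral_2_eq_2 algebra_simps)
    finally show "\<bar>f q * g q - f p * g p\<bar> \<le> max 0 (max A B) * (q - p + (\<Sum>i<2. \<bar>h i q - h i p\<bar>))" .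
  qed (use f g in \<open>auto simp: h_def\<close>)
qed

lemma absolutely_continuous_on_sum:
  fixes n :: nat
  assumes "\<And>i. i < n \<Longrightarrow> absolutely_continuous_on {a..b} (g i)"
  shows "absolutely_continuous_on {a..b} (\<lambda>x. \<Sum>i<n. g i x)"
proof (rule absolutely_continuous_on_dominated[where C = 1, OF assms])
  fix p q :: real assume "a \<le> p" "p < q" "q \<le> b"
  then show "\<bar>(\<Sum>i<n. g i q) - (\<Sum>i<n. g i p)\<bar> \<le> 1 * (q - p + (\<Sum>i<n. \<bar>g i q - g i p\<bar>))"
    using sum_abs[of "\<lambda>i. g i q - g i p" "{..<n}"] by (simp add: sum_subtractf)
qed auto

text \<open>Absolute continuity bounds the variation directly on intervals shorter than the
  \<open>\<delta>\<close> that belongs to 1. Negligibility is a local property, so such intervals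
  suffice.\<close>

lemma negligible_not_differentiable_absolutely_continuous:
  assumes "absolutely_continuous_on {a..b} f"
  shows "negligible {x \<in> {a<..<b}. \<not> f differentiable at x}" (is "negligible ?E")
  unfolding locally_negligible_alt[of ?E]
proof
  fix x assume x: "x \<in> ?E"
  obtain \<delta> where \<delta>: "\<delta> > 0" "\<forall>I. interval_family a b I \<longrightarrow> (\<Sum>(p, q)\<in>I. q - p) < \<delta> \<longrightarrow>
    (\<Sum>(p, q)\<in>I. \<bar>f q - f p\<bar>) < 1"
    using assms zero_less_one unfolding absolutely_continuous_on_Icc_iff by blast
  define r where "r = min (\<delta> / 3) (min (x - a) (b - x))"
  have r: "r > 0" "2 * r < \<delta>" "a \<le> x - r" "x + r \<le> b" using x \<delta>(1) by (auto simp: r_def min_def)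
  have "negligible {y \<in> {x - r<..<x + r}. \<not> f differentiable at y}"
  proof (rule negligible_not_differentiable[where M = 1])
    fix I assume I: "interval_family (x - r) (x + r) I"
    have "(\<Sum>(p, q)\<in>I. q - p) \<le> (x + r) - (x - r)"
      using sum_increments_le[OF I, of "\<lambda>x. x"] r by (simp add: mono_on_def)
    then show "(\<Sum>(p, q)\<in>I. \<bar>f q - f p\<bar>) \<le> 1"
      using \<delta>(2) interval_family_mono[OF I r(3,4)] r by (simp add: less_imp_le)
  qed (use r in simp)
  then have "negligible (?E \<inter> {x - r<..<x + r})" by (rule negligible_subset) auto
  then show "\<exists>U. openin (top_of_set ?E) U \<and> x \<in> U \<and> negligible U"
    using x r by (intro exI[of _ "?E \<inter> {x - r<..<x + r}"]) (auto simp: openin_open_Int)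
qed

section \<open>The fundamental theorem of calculus for absolutely continuous functions\<close>

lemma sum_lengths_le_measure:
  assumes "interval_family a b I" "U \<in> lmeasurable" "\<And>p q. (p, q) \<in> I \<Longrightarrow> {p<..<q} \<subseteq> U"
  shows "(\<Sum>(p, q)\<in>I. q - p) \<le> measure lebesgue U"
proof -
  have I: "finite I" "disjoint_family_on (\<lambda>(p, q). {p<..<q}) I"
    using assms(1) by (auto simp: interval_family_def)
  have "(\<Sum>(p, q)\<in>I. q - p) = (\<Sum>i\<in>I. measure lebesgue (case i of (p, q) \<Rightarrow> {p<..<q}))"
    using interval_familyD(2)[OF assms(1)] by (intro sum.cong) (auto simp: less_imp_le)
  also have "\<dots> = measure lebesgue (\<Union>i\<in>I. case i of (p, q) \<Rightarrow> {p<..<q})"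
    by (rule measure_finite_Union[symmetric]) (use I interval_familyD(2)[OF assms(1)] in \<open>auto simp: less_imp_le\<close>)
  also have "\<dots> \<le> measure lebesgue U"
    by (rule measure_mono_fmeasurable) (use assms I in auto)
  finally show ?thesis .
qed

lemma negligible_outer_open:
  fixes N :: "real set"
  assumes "negligible N" "\<epsilon> > 0"
  obtains U where "open U" "N \<subseteq> U" "U \<in> lmeasurable" "measure lebesgue U < \<epsilon>"
proof -
  have N: "N \<in> null_sets lebesgue" using assms(1) by (simp add: negligible_iff_null_sets)
  obtain U where U: "open U" "N \<subseteq> U" "U - N \<in> lmeasurable" "emeasure lebesgue (U - N) < ennreal \<epsilon>"
    using sets_lebesgue_outer_open[OF _ assms(2)] N by blast
  have UN: "U = (U - N) \<union> N" using U(2) by auto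
  have "U \<in> lmeasurable"
    using fmeasurable.Un[OF U(3), of N] assms(1) UN by (simp add: negligible_imp_measurable)
  moreover have "measure lebesgue U = measure lebesgue (U - N)"
    using N U(1) by (simp add: measure_Diff_null_set)
  moreover have "measure lebesgue (U - N) < \<epsilon>"
    using U(3,4) \<open>\<epsilon> > 0\<close> by (simp add: emeasure_eq_measure2 ennreal_less_iff)
  ultimately show thesis using that U(1,2) by simp
qed

text \<open>The gauge is chosen by the kind of tag. At a tag outside \<open>N\<close>,
  differentiability makes the error proportional to the length. Tags in \<open>N\<close> carry
  intervals inside an open set of measure below \<open>\<delta>\<close>, where absolute continuity
  makes the increments of \<open>f\<close> small. Integrability of \<open>f'\<close> comes out as
  part of the conclusion.\<close>

lemma fundamental_theorem_absolutely_continuous: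
  assumes ac: "absolutely_continuous_on {a..b} f" and "a \<le> b" and N: "negligible N"
    and der: "\<And>x. x \<in> {a..b} - N \<Longrightarrow> (f has_vector_derivative f' x) (at x within {a..b})"
  shows "(f' has_integral (f b - f a)) {a..b}"
proof -
  \<comment> \<open>With the value 0 on \<open>N\<close>, a tag in \<open>N\<close> contributes only
    the increment of \<open>f\<close>.\<close>
  define g where "g x = (if x \<in> N then 0 else f' x)" for x
  have "(g has_integral (f b - f a)) {a..b}"
    unfolding has_integral_real
  proof (intro allI impI)
    fix e :: real assume "e > 0"
    \<comment> \<open>The summand 1 avoids division by zero when \<open>a = b\<close> and makes the
      estimate strict.\<close>
    define \<eta> where "\<eta> = e / (2 * (b - a + 1))"
    have \<eta>: "\<eta> > 0" "\<eta> * (b - a) < e / 2" using \<open>e > 0\<close> \<open>a \<le> b\<close> by (auto simp: \<eta>_def field_simps)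
    obtain \<delta> where \<delta>: "\<delta> > 0" "\<forall>I. interval_family a b I \<longrightarrow> (\<Sum>(p, q)\<in>I. q - p) < \<delta> \<longrightarrow>
      (\<Sum>(p, q)\<in>I. \<bar>f q - f p\<bar>) < e / 2"
      using ac \<open>e > 0\<close> half_gt_zero unfolding absolutely_continuous_on_Icc_iff by blast
    obtain U where U: "open U" "N \<subseteq> U" "U \<in> lmeasurable" "measure lebesgue U < \<delta>"
      using negligible_outer_open[OF N \<delta>(1)] by blast
    have "\<forall>x. \<exists>d>0. (x \<in> N \<longrightarrow> ball x d \<subseteq> U) \<and> (x \<in> {a..b} - N \<longrightarrow>
      (\<forall>y\<in>{a..b}. norm (y - x) < d \<longrightarrow> norm (f y - f x - (y - x) *\<^sub>R f' x) \<le> \<eta> * norm (y - x)))"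
    proof
      fix x
      show "\<exists>d>0. (x \<in> N \<longrightarrow> ball x d \<subseteq> U) \<and> (x \<in> {a..b} - N \<longrightarrow>
        (\<forall>y\<in>{a..b}. norm (y - x) < d \<longrightarrow> norm (f y - f x - (y - x) *\<^sub>R f' x) \<le> \<eta> * norm (y - x)))"
      proof (cases "x \<in> N")
        case True
        then show ?thesis using U(1,2) open_contains_ball by blast
      next
        case False
        show ?thesis
        proof (cases "x \<in> {a..b}")
          case True
          then show ?thesis
            using der[of x] False \<eta>(1) unfolding has_vector_derivative_def has_derivative_within_alt by blast
        next
          case False then show ?thesis using \<open>x \<notin> N\<close> zero_less_one by blast
        qed
      qed
    qed
    then obtain d where d: "\<And>x. d x > 0" "\<And>x. x \<in> N \<Longrightarrow> ball x (d x) \<subseteq> U"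
      "\<And>x y. x \<in> {a..b} - N \<Longrightarrow> y \<in> {a..b} \<Longrightarrow> norm (y - x) < d x \<Longrightarrow>
        norm (f y - f x - (y - x) *\<^sub>R f' x) \<le> \<eta> * norm (y - x)"
      by metis
    have "norm ((\<Sum>(x, K)\<in>\<D>. measure lborel K *\<^sub>R g x) - (f b - f a)) < e"
      if \<D>: "\<D> tagged_division_of {a..b}" and fine: "(\<lambda>x. ball x (d x)) fine \<D>" for \<D>
    proof -
      note fin = tagged_division_of_finite[OF \<D>]
      have K: "K = {Inf K..Sup K}" "a \<le> Inf K" "Inf K \<le> x" "x \<le> Sup K" "Sup K \<le> b"
        "Inf K \<in> ball x (d x)" "Sup K \<in> ball x (d x)" "K \<subseteq> ball x (d x)" if xK: "(x, K) \<in> \<D>" for x K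
      proof -
        have "x \<in> K" "K \<subseteq> {a..b}" "\<exists>u v. K = cbox u v" using tagged_division_ofD[OF \<D>] xK by blast+
        then obtain u v where uv: "K = {u..v}" "u \<le> x" "x \<le> v" "a \<le> u" "v \<le> b" by force
        moreover show sub: "K \<subseteq> ball x (d x)" using fine xK by (auto simp: fine_def)
        moreover have "u \<in> K" "v \<in> K" using uv by auto
        then have "u \<in> ball x (d x)" "v \<in> ball x (d x)" using sub by blast+
        ultimately show "K = {Inf K..Sup K}" "a \<le> Inf K" "Inf K \<le> x" "x \<le> Sup K" "Sup K \<le> b"
          "Inf K \<in> ball x (d x)" "Sup K \<in> ball x (d x)" by auto
      qed
      have content: "measure lborel K = Sup K - Inf K" if "(x, K) \<in> \<D>" for x K
        using K[OF that] by (metis content_real order_trans)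
      define \<D>1 \<D>2 where "\<D>1 = {(x, K) \<in> \<D>. x \<notin> N}" and "\<D>2 = {(x, K) \<in> \<D>. x \<in> N}"
      have split: "\<D> = \<D>1 \<union> \<D>2" "\<D>1 \<inter> \<D>2 = {}" "finite \<D>1" "finite \<D>2"
        using fin by (auto simp: \<D>1_def \<D>2_def intro: finite_subset)
      have sum_f: "f b - f a = (\<Sum>(x, K)\<in>\<D>. f (Sup K) - f (Inf K))"
        and sum_id: "b - a = (\<Sum>(x, K)\<in>\<D>. Sup K - Inf K)"
        using additive_tagged_division_1[OF \<open>a \<le> b\<close> \<D>, of f]
          additive_tagged_division_1[OF \<open>a \<le> b\<close> \<D>, of "\<lambda>x. x"] by simp_all
      have "(\<Sum>(x, K)\<in>\<D>. measure lborel K *\<^sub>R g x) - (f b - f a)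
        = (\<Sum>(x, K)\<in>\<D>. measure lborel K *\<^sub>R g x - (f (Sup K) - f (Inf K)))"
        unfolding sum_f by (simp add: sum_subtractf case_prod_beta)
      also have "\<dots> = (\<Sum>(x, K)\<in>\<D>1. measure lborel K *\<^sub>R g x - (f (Sup K) - f (Inf K)))
        + (\<Sum>(x, K)\<in>\<D>2. measure lborel K *\<^sub>R g x - (f (Sup K) - f (Inf K)))"
        unfolding split(1) by (rule sum.union_disjoint) (use split in auto)
      finally have eq: "(\<Sum>(x, K)\<in>\<D>. measure lborel K *\<^sub>R g x) - (f b - f a) =
        (\<Sum>(x, K)\<in>\<D>1. measure lborel K *\<^sub>R g x - (f (Sup K) - f (Inf K)))
        + (\<Sum>(x, K)\<in>\<D>2. measure lborel K *\<^sub>R g x - (f (Sup K) - f (Inf K)))" .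
      have "norm (\<Sum>(x, K)\<in>\<D>1. measure lborel K *\<^sub>R g x - (f (Sup K) - f (Inf K)))
        \<le> (\<Sum>(x, K)\<in>\<D>1. \<eta> * (Sup K - Inf K))"
      proof (rule sum_norm_le, clarify)
        fix x K assume "(x, K) \<in> \<D>1"
        then have xK: "(x, K) \<in> \<D>" "x \<notin> N" by (auto simp: \<D>1_def)
        note k = K[OF xK(1)]
        define u v where "u = Inf K" and "v = Sup K"
        have le: "a \<le> u" "u \<le> x" "x \<le> v" "v \<le> b" and c: "measure lborel K = v - u"
          using k content[OF xK(1)] by (auto simp: u_def v_def)
        have 1: "\<bar>f u - f x - (u - x) * f' x\<bar> \<le> \<eta> * (x - u)"
          using d(3)[of x u] xK k le by (auto simp: dist_real_def u_def)
        have 2: "\<bar>f v - f x - (v - x) * f' x\<bar> \<le> \<eta> * (v - x)"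
          using d(3)[of x v] xK k le by (auto simp: dist_real_def v_def)
        have "(v - u) * f' x - (f v - f u) = (f u - f x - (u - x) * f' x) - (f v - f x - (v - x) * f' x)"
          by (simp add: algebra_simps)
        then have "\<bar>(v - u) * f' x - (f v - f u)\<bar> \<le> \<eta> * (x - u) + \<eta> * (v - x)" using 1 2 by linarith
        also have "\<dots> = \<eta> * (v - u)" by (simp add: algebra_simps)
        finally show "norm (measure lborel K *\<^sub>R g x - (f (Sup K) - f (Inf K))) \<le> \<eta> * (Sup K - Inf K)"
          using xK(2) c by (simp add: g_def u_def v_def)
      qed
      also have "\<dots> \<le> (\<Sum>(x, K)\<in>\<D>. \<eta> * (Sup K - Inf K))"
      proof (rule sum_mono2[OF fin])
        show "0 \<le> (case z of (x, K) \<Rightarrow> \<eta> * (Sup K - Inf K))" if "z \<in> \<D> - \<D>1" for z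
          using that K(3,4) \<eta>(1) by (cases z) fastforce
      qed (auto simp: \<D>1_def)
      also have "\<dots> = \<eta> * (b - a)" unfolding sum_id by (simp add: sum_distrib_left case_prod_beta)
      finally have part1: "norm (\<Sum>(x, K)\<in>\<D>1. measure lborel K *\<^sub>R g x - (f (Sup K) - f (Inf K))) < e / 2"
        using \<eta>(2) by linarith
      \<comment> \<open>Degenerate intervals are dropped: an \<open>interval_family\<close> has
        none, and on the others forgetting the tag is injective.\<close>
      define \<D>3 where "\<D>3 = {(x, K) \<in> \<D>2. Inf K < Sup K}"
      define h where "h = (\<lambda>(x :: real, K :: real set). (Inf K, Sup K))"
      have apart: "Sup K \<le> Inf L \<or> Sup L \<le> Inf K"
        if "(x, K) \<in> \<D>3" "(y, L) \<in> \<D>3" "(x, K) \<noteq> (y, L)" for x K y L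
      proof (rule ccontr)
        assume n: "\<not> (Sup K \<le> Inf L \<or> Sup L \<le> Inf K)"
        have 0: "(x, K) \<in> \<D>" "(y, L) \<in> \<D>" "Inf K < Sup K" "Inf L < Sup L" using that by (auto simp: \<D>3_def \<D>2_def)
        have "interior K \<inter> interior L = {}" using tagged_division_ofD(5)[OF \<D> 0(1,2) that(3)] .
        moreover have "interior K = {Inf K<..<Sup K}" "interior L = {Inf L<..<Sup L}"
          using K(1)[OF 0(1)] K(1)[OF 0(2)] by (metis interior_atLeastAtMost_real interior_cbox box_real)+
        moreover obtain z where "max (Inf K) (Inf L) < z" "z < min (Sup K) (Sup L)"
          using dense[of "max (Inf K) (Inf L)" "min (Sup K) (Sup L)"] n 0(3,4) by auto
        ultimately show False by auto
      qed
      have inj: "inj_on h \<D>3"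
      proof (rule inj_onI, clarify)
        fix x K y L assume *: "(x, K) \<in> \<D>3" "(y, L) \<in> \<D>3" "h (x, K) = h (y, L)"
        then have "Inf K = Inf L" "Sup K = Sup L" "Inf K < Sup K" by (auto simp: h_def \<D>3_def)
        then show "x = y \<and> K = L" using apart[OF *(1,2)] by auto
      qed
      have fam: "interval_family a b (h ` \<D>3)"
      proof (rule interval_familyI)
        show "finite (h ` \<D>3)" using split(4) by (auto simp: \<D>3_def intro: finite_subset)
        show "a \<le> p \<and> p < q \<and> q \<le> b" if "(p, q) \<in> h ` \<D>3" for p q
          using that K(2,5) by (auto simp: h_def \<D>3_def \<D>2_def)
        show "q \<le> p' \<or> q' \<le> p" if "(p, q) \<in> h ` \<D>3" "(p', q') \<in> h ` \<D>3" "(p, q) \<noteq> (p', q')" for p q p' q'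
          using that apart by (auto simp: h_def)
      qed
      have "(\<Sum>(p, q)\<in>h ` \<D>3. q - p) \<le> measure lebesgue U"
      proof (rule sum_lengths_le_measure[OF fam U(3)])
        fix p q assume "(p, q) \<in> h ` \<D>3"
        then obtain x K where xK: "(x, K) \<in> \<D>" "x \<in> N" "p = Inf K" "q = Sup K" by (auto simp: h_def \<D>3_def \<D>2_def)
        have "{p<..<q} \<subseteq> K" using K(1)[OF xK(1)] xK(3,4) by (metis greaterThanLessThan_subseteq_atLeastAtMost_iff order_refl)
        also have "K \<subseteq> U" using K(8)[OF xK(1)] d(2)[OF xK(2)] by blast
        finally show "{p<..<q} \<subseteq> U" .
      qed
      then have "(\<Sum>(p, q)\<in>h ` \<D>3. \<bar>f q - f p\<bar>) < e / 2" using \<delta>(2) fam U(4) by simp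
      moreover have "(\<Sum>(p, q)\<in>h ` \<D>3. \<bar>f q - f p\<bar>) = (\<Sum>(x, K)\<in>\<D>3. \<bar>f (Sup K) - f (Inf K)\<bar>)"
        by (subst sum.reindex[OF inj]) (auto simp: h_def case_prod_beta)
      moreover have "(\<Sum>(x, K)\<in>\<D>3. \<bar>f (Sup K) - f (Inf K)\<bar>) = (\<Sum>(x, K)\<in>\<D>2. \<bar>f (Sup K) - f (Inf K)\<bar>)"
      proof (rule sum.mono_neutral_left[OF split(4)])
        show "\<forall>z\<in>\<D>2 - \<D>3. (case z of (x, K) \<Rightarrow> \<bar>f (Sup K) - f (Inf K)\<bar>) = 0"
        proof clarify
          fix x K assume "(x, K) \<in> \<D>2" "(x, K) \<notin> \<D>3"
          then have "Inf K = Sup K" using K(3,4)[of x K] by (auto simp: \<D>3_def \<D>2_def)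
          then show "\<bar>f (Sup K) - f (Inf K)\<bar> = 0" by simp
        qed
      qed (auto simp: \<D>3_def)
      moreover have "norm (\<Sum>(x, K)\<in>\<D>2. measure lborel K *\<^sub>R g x - (f (Sup K) - f (Inf K)))
        \<le> (\<Sum>(x, K)\<in>\<D>2. \<bar>f (Sup K) - f (Inf K)\<bar>)"
        by (rule sum_norm_le) (auto simp: \<D>2_def g_def abs_minus_commute)
      ultimately have "norm (\<Sum>(x, K)\<in>\<D>2. measure lborel K *\<^sub>R g x - (f (Sup K) - f (Inf K))) < e / 2" by linarith
      with part1 show ?thesis unfolding eq by (metis (no_types) field_sum_of_halves norm_triangle_lt add_strict_mono)
    qed
    then show "\<exists>\<gamma>. gauge \<gamma> \<and> (\<forall>\<D>. \<D> tagged_division_of {a..b} \<and> \<gamma> fine \<D> \<longrightarrow>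
      norm ((\<Sum>(x, K)\<in>\<D>. measure lborel K *\<^sub>R g x) - (f b - f a)) < e)"
      using d(1) by (intro exI[of _ "\<lambda>x. ball x (d x)"]) (auto intro: gauge_ball_dependent)
  qed
  then show ?thesis by (rule has_integral_spike[OF N, rotated]) (auto simp: g_def)
qed

section \<open>Taylor's formula and iterated integrals\<close>

lemma nth_deriv_0 [simp]: "nth_deriv 0 f = f"
  by (simp add: nth_deriv_def)

lemma nth_deriv_Suc: "nth_deriv (Suc k) f x = vector_derivative (nth_deriv k f) (at x within {0..1})"
  by (simp add: nth_deriv_def)

text \<open>Only the derivative of order \<open>m - 1\<close> can fail to be differentiable
  somewhere, so one null set serves all orders. The endpoints join it because almost everywhere
  differentiability is known for the open interval.\<close>

lemma sobolev_has_derivatives: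
  assumes "f \<in> sobolev_W m"
  obtains N where "negligible N" "\<And>k x. k < m \<Longrightarrow> x \<in> {0..1} - N \<Longrightarrow>
    (nth_deriv k f has_vector_derivative nth_deriv (Suc k) f x) (at x within {0..1})"
proof -
  define N where "N = {x \<in> {0<..<1}. \<not> nth_deriv (m - 1) f differentiable at x} \<union> {0, 1}"
  have ac: "absolutely_continuous_on {0..1} (nth_deriv k f)" if "k < m" for k
    using assms that by (auto simp: sobolev_W_def)
  have "(nth_deriv k f has_vector_derivative nth_deriv (Suc k) f x) (at x within {0..1})"
    if k: "k < m" and x: "x \<in> {0..1} - N" for k x
  proof -
    have "nth_deriv k f differentiable (at x within {0..1})"
    proof (cases "Suc k < m")
      case True
      then show ?thesis using assms x by (auto simp: sobolev_W_def differentiable_on_def)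
    next
      case False
      then have "k = m - 1" using k by simp
      then show ?thesis using x differentiable_at_withinI unfolding N_def by force
    qed
    then show ?thesis unfolding nth_deriv_Suc by (simp add: vector_derivative_works)
  qed
  moreover have "negligible N" if "m > 0"
    unfolding N_def using negligible_not_differentiable_absolutely_continuous[OF ac[of "m - 1"]] that
    by (intro negligible_Un) auto
  ultimately show thesis by (cases "m = 0") (use that[of "{}"] that[of N] in auto)
qed

text \<open>The kernel of the remainder in Taylor's formula, with \<open>u\<close> as the variable
  of integration. The case distinction makes it the indicator of \<open>u < t\<close> for
  \<open>m = 1\<close>, where a power of the positive part would be 1 everywhere because
  \<open>0 ^ 0 = 1\<close>.\<close>

definition truncated_power :: "nat \<Rightarrow> real \<Rightarrow> real \<Rightarrow> real" where
  "truncated_power m t u = (if u < t then (t - u) ^ (m - 1) / fact (m - 1) else 0)"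

lemma absolutely_continuous_on_affine_power:
  fixes t c :: real
  shows "absolutely_continuous_on {a..b} (\<lambda>u. (t - u) ^ k / c)"
proof -
  have const: "absolutely_continuous_on {a..b} (\<lambda>u. d)" for d :: real
    by (rule lipschitz_imp_absolutely_continuous_on[where C = 0]) (simp add: lipschitz_on_constant)
  have lin: "absolutely_continuous_on {a..b} (\<lambda>u. t - u)"
    by (rule lipschitz_imp_absolutely_continuous_on[where C = 1]) (simp add: lipschitz_on_def dist_real_def abs_minus_commute)
  have "absolutely_continuous_on {a..b} (\<lambda>u. (t - u) ^ k)"
    by (induction k) (auto intro: const lin absolutely_continuous_on_mult)
  from absolutely_continuous_on_mult[OF this const[of "1 / c"]] show ?thesis by simp
qed

text \<open>The Taylor polynomial with centre \<open>u\<close>, evaluated at the fixed point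
  \<open>t\<close>, is absolutely continuous in \<open>u\<close>, and in its derivative all terms
  telescope but the one of top order. Integrating over \<open>[0, t]\<close> moves the centre from 0
  to \<open>t\<close>, where the polynomial equals \<open>f t\<close>.\<close>

theorem sobolev_taylor:
  assumes f: "f \<in> sobolev_W m" and "m \<ge> 1" and t: "t \<in> {0..1}"
  shows "((\<lambda>u. truncated_power m t u * nth_deriv m f u) has_integral
    f t - (\<Sum>k<m. nth_deriv k f 0 * t ^ k / fact k)) {0..1}"
proof -
  obtain N where N: "negligible N" "\<And>k x. k < m \<Longrightarrow> x \<in> {0..1} - N \<Longrightarrow>
    (nth_deriv k f has_vector_derivative nth_deriv (Suc k) f x) (at x within {0..1})"
    using sobolev_has_derivatives[OF f] by metis
  define F where "F j u = (\<Sum>k<j. nth_deriv k f u * ((t - u) ^ k / fact k))" for j u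
  have der: "(F (Suc j) has_vector_derivative nth_deriv (Suc j) f u * ((t - u) ^ j / fact j)) (at u within {0..1})"
    if u: "u \<in> {0..1} - N" and "j < m" for j u
    using \<open>j < m\<close>
  proof (induction j)
    case 0
    then show ?case using N(2)[of 0 u] u by (simp add: F_def)
  next
    case (Suc j)
    have "((\<lambda>u. (t - u) ^ Suc j / fact (Suc j)) has_vector_derivative - ((t - u) ^ j / fact j)) (at u within {0..1})"
      unfolding has_real_derivative_iff_has_vector_derivative[symmetric]
      by (rule derivative_eq_intros refl | simp)+
    from has_vector_derivative_mult[OF N(2)[OF Suc.prems u] this]
    have "((\<lambda>u. nth_deriv (Suc j) f u * ((t - u) ^ Suc j / fact (Suc j))) has_vector_derivative
      nth_deriv (Suc j) f u * - ((t - u) ^ j / fact j) + nth_deriv (Suc (Suc j)) f u * ((t - u) ^ Suc j / fact (Suc j)))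
      (at u within {0..1})" .
    from has_vector_derivative_add[OF Suc.IH this] Suc.prems show ?case
      by (simp add: F_def[abs_def] algebra_simps)
  qed
  have ac: "absolutely_continuous_on {0..1} (F m)"
    unfolding F_def
  proof (intro absolutely_continuous_on_sum absolutely_continuous_on_mult)
    show "absolutely_continuous_on {0..1} (nth_deriv k f)" if "k < m" for k
      using f that by (auto simp: sobolev_W_def)
  qed (rule absolutely_continuous_on_affine_power)
  define r where "r u = nth_deriv m f u * ((t - u) ^ (m - 1) / fact (m - 1))" for u
  have "(r has_integral F m t - F m 0) {0..t}"
  proof (rule fundamental_theorem_absolutely_continuous[OF _ _ N(1)])
    show "absolutely_continuous_on {0..t} (F m)"
      using absolutely_continuous_on_subinterval[OF ac, of 0 t] t by simp
    show "(F m has_vector_derivative r u) (at u within {0..t})" if "u \<in> {0..t} - N" for u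
    proof (rule has_vector_derivative_within_subset)
      show "(F m has_vector_derivative r u) (at u within {0..1})"
        using der[of u "m - 1"] that t \<open>m \<ge> 1\<close> by (simp add: r_def)
    qed (use t in auto)
  qed (use t in simp)
  moreover have "F m t = f t"
  proof -
    have "F m t = (\<Sum>k\<in>{0}. nth_deriv k f t * ((t - t) ^ k / fact k))"
      unfolding F_def by (rule sum.mono_neutral_right) (use \<open>m \<ge> 1\<close> in auto)
    then show ?thesis by simp
  qed
  ultimately have "(r has_integral f t - (\<Sum>k<m. nth_deriv k f 0 * t ^ k / fact k)) {0..t}"
    by (simp add: F_def)
  then have "((\<lambda>u. if u \<in> {0..t} then r u else 0) has_integral
    f t - (\<Sum>k<m. nth_deriv k f 0 * t ^ k / fact k)) {0..1}"
    by (subst has_integral_restrict) (use t in auto)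
  \<comment> \<open>At \<open>u = t\<close> the integrands may differ for \<open>m = 1\<close>,
    where \<open>(t - u) ^ 0\<close> is 1 and the kernel is 0.\<close>
  then show ?thesis
    by (rule has_integral_spike_finite[where S = "{t}", rotated 2]) (auto simp: truncated_power_def r_def)
qed

text \<open>The solution on \<open>[0, 1]\<close> of the initial value problem whose derivatives at
  0 are \<open>a k\<close> for \<open>k < m\<close> and whose \<open>m\<close>-th derivative is
  \<open>G\<close> wherever \<open>G\<close> is continuous.\<close>

primrec iterated_integral :: "nat \<Rightarrow> (nat \<Rightarrow> real) \<Rightarrow> (real \<Rightarrow> real) \<Rightarrow> real \<Rightarrow> real" where
  "iterated_integral 0 a G = G"
| "iterated_integral (Suc m) a G = (\<lambda>x. a 0 + integral {0..x} (iterated_integral m (\<lambda>k. a (Suc k)) G))"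

lemma iterated_integral_at_0: "m > 0 \<Longrightarrow> iterated_integral m a G 0 = a 0"
  by (cases m) auto

lemma lipschitz_on_integral:
  fixes G :: "real \<Rightarrow> real"
  assumes "G integrable_on {0..1}" "\<And>x. x \<in> {0..1} \<Longrightarrow> \<bar>G x\<bar> \<le> B"
  shows "B-lipschitz_on {0..1} (\<lambda>x. c + integral {0..x} G)"
proof -
  have "\<bar>integral {0..y} G - integral {0..x} G\<bar> \<le> B * (y - x)" if "0 \<le> x" "x \<le> y" "y \<le> 1" for x y
  proof -
    have "G integrable_on {0..y}" "G integrable_on {x..y}"
      using that by (auto intro: integrable_subinterval_real[OF assms(1)])
    then have "integral {0..x} G + integral {x..y} G = integral {0..y} G"
      using that by (intro Henstock_Kurzweil_Integration.integral_combine) auto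
    moreover have "norm (integral {x..y} G) \<le> B * (y - x)"
      using has_integral_bound_real[OF _ finite.emptyI integrable_integral[OF \<open>G integrable_on {x..y}\<close>], of B]
        assms(2) order_trans[OF abs_ge_zero assms(2)[of 0]] that by simp
    ultimately show ?thesis by simp
  qed
  note * = this
  show ?thesis
  proof (rule lipschitz_onI)
    show "0 \<le> B" using assms(2)[of 0] by force
    fix x y :: real assume "x \<in> {0..1}" "y \<in> {0..1}"
    then show "dist (c + integral {0..x} G) (c + integral {0..y} G) \<le> B * dist x y"
      using *[of x y] *[of y x] by (cases "x \<le> y") (auto simp: dist_real_def abs_minus_commute)
  qed
qed

text \<open>Proved together because each level feeds the next: integrability and a bound make the
  integral Lipschitz, and this returns both. Level 0 is only bounded, since \<open>G\<close> may
  jump.\<close>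

lemma iterated_integral_bounded:
  assumes "G integrable_on {0..1}" "bounded (G ` {0..1})"
  shows "iterated_integral m a G integrable_on {0..1} \<and> bounded (iterated_integral m a G ` {0..1}) \<and>
    (m > 0 \<longrightarrow> (\<exists>B. B-lipschitz_on {0..1} (iterated_integral m a G)))"
proof (induction m arbitrary: a)
  case (Suc m)
  obtain B where "\<And>x. x \<in> {0..1} \<Longrightarrow> \<bar>iterated_integral m (\<lambda>k. a (Suc k)) G x\<bar> \<le> B"
    using Suc[of "\<lambda>k. a (Suc k)"] unfolding bounded_iff by (metis imageI real_norm_def)
  then have B: "B-lipschitz_on {0..1} (iterated_integral (Suc m) a G)"
    using lipschitz_on_integral Suc[of "\<lambda>k. a (Suc k)"] by simp
  from lipschitz_on_continuous_on[OF this] have "continuous_on {0..1} (iterated_integral (Suc m) a G)" .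
  then show ?case
    using B integrable_continuous_real compact_imp_bounded[OF compact_continuous_image] by blast
qed (use assms in simp)

text \<open>The integral is differentiable where its integrand is continuous. From level 1 on the
  integrand is Lipschitz, so the discontinuities in \<open>S\<close> matter only for
  \<open>m = 0\<close>.\<close>

lemma iterated_integral_has_vector_derivative:
  assumes G: "G integrable_on {0..1}" "bounded (G ` {0..1})"
    and cont: "\<forall>x\<in>{0..1} - S. continuous (at x within {0..1}) G"
    and x: "x \<in> {0..1}" "m > 0 \<or> x \<notin> S"
  shows "(iterated_integral (Suc m) a G has_vector_derivative iterated_integral m (\<lambda>k. a (Suc k)) G x)
    (at x within {0..1})"
proof -
  let ?H = "iterated_integral m (\<lambda>k. a (Suc k)) G"
  note H = iterated_integral_bounded[OF G, of m "\<lambda>k. a (Suc k)"]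
  have "continuous (at x within {0..1}) ?H"
  proof (cases "m > 0")
    case True
    then show ?thesis using H x(1) lipschitz_on_continuous_on continuous_on_eq_continuous_within by blast
  next
    case False then show ?thesis using cont x by simp
  qed
  then have "((\<lambda>x. integral {0..x} ?H) has_vector_derivative ?H x) (at x within {0..1})"
    using integral_has_vector_derivative_continuous_at[of ?H 0 1 x "{}"] H x(1) by simp
  from has_vector_derivative_add[OF has_vector_derivative_const this, of "a 0"] show ?thesis by simp
qed

text \<open>Orders below \<open>m\<close> have to be identified at every point of
  \<open>[0, 1]\<close>, since the next derivative depends on all values nearby; only at order
  \<open>m\<close> do the points of \<open>S\<close> drop out.\<close>

lemma nth_deriv_iterated_integral:
  assumes G: "G integrable_on {0..1}" "bounded (G ` {0..1})"
    and cont: "\<forall>x\<in>{0..1} - S. continuous (at x within {0..1}) G"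
    and "k \<le> m" "x \<in> {0..1}" "k < m \<or> x \<notin> S"
  shows "nth_deriv k (iterated_integral m a G) x = iterated_integral (m - k) (\<lambda>i. a (i + k)) G x"
  using assms(4-)
proof (induction k arbitrary: x)
  case (Suc k)
  define l where "l = m - Suc k"
  have l: "m - k = Suc l" "m - Suc k = l" using Suc.prems by (auto simp: l_def)
  have "(nth_deriv k (iterated_integral m a G) has_vector_derivative iterated_integral l (\<lambda>i. a (i + Suc k)) G x)
    (at x within {0..1})"
  proof (rule has_vector_derivative_transform[OF Suc.prems(2)])
    show "nth_deriv k (iterated_integral m a G) y = iterated_integral (Suc l) (\<lambda>i. a (i + k)) G y"
      if "y \<in> {0..1}" for y using Suc.IH[of y] Suc.prems(1) that l by simp
    show "(iterated_integral (Suc l) (\<lambda>i. a (i + k)) G has_vector_derivative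
      iterated_integral l (\<lambda>i. a (i + Suc k)) G x) (at x within {0..1})"
      using iterated_integral_has_vector_derivative[OF G cont Suc.prems(2), where m = l and a = "\<lambda>i. a (i + k)"]
        Suc.prems l by (simp del: iterated_integral.simps) (auto simp del: iterated_integral.simps)
  qed
  then show ?case
    unfolding nth_deriv_Suc l using vector_derivative_within_closed_interval[OF zero_less_one Suc.prems(2)] by blast
qed simp

lemma iterated_integral_in_sobolev_W:
  assumes G: "G integrable_on {0..1}" "bounded (G ` {0..1})"
    and cont: "\<forall>x\<in>{0..1} - S. continuous (at x within {0..1}) G" and "finite S"
    and sq: "(\<lambda>x. (G x)\<^sup>2) absolutely_integrable_on {0..1}"
  shows "iterated_integral m a G \<in> sobolev_W m"
proof -
  let ?f = "iterated_integral m a G"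
  note eq = nth_deriv_iterated_integral[OF G cont, where m = m and a = a]
  have "nth_deriv k ?f differentiable_on {0..1}" if k: "Suc k < m" for k
    unfolding differentiable_on_def
  proof
    fix x :: real assume x: "x \<in> {0..1}"
    define l where "l = m - Suc k"
    have l: "m - k = Suc l" "l > 0" using k by (auto simp: l_def)
    have "(nth_deriv k ?f has_vector_derivative iterated_integral l (\<lambda>i. a (Suc i + k)) G x) (at x within {0..1})"
    proof (rule has_vector_derivative_transform[OF x])
      show "nth_deriv k ?f y = iterated_integral (Suc l) (\<lambda>i. a (i + k)) G y" if "y \<in> {0..1}" for y
        using eq[of k y] that k l by simp
      show "(iterated_integral (Suc l) (\<lambda>i. a (i + k)) G has_vector_derivative
        iterated_integral l (\<lambda>i. a (Suc i + k)) G x) (at x within {0..1})"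
        using iterated_integral_has_vector_derivative[OF G cont x, where m = l and a = "\<lambda>i. a (i + k)"] l(2)
        by (simp del: iterated_integral.simps)
    qed
    then show "nth_deriv k ?f differentiable (at x within {0..1})"
      unfolding has_vector_derivative_def differentiable_def by blast
  qed
  moreover have "absolutely_continuous_on {0..1} (nth_deriv k ?f)" if k: "k < m" for k
  proof -
    have "\<exists>B. B-lipschitz_on {0..1} (iterated_integral (m - k) (\<lambda>i. a (i + k)) G)"
      using iterated_integral_bounded[OF G] k by simp
    moreover have "nth_deriv k ?f x = iterated_integral (m - k) (\<lambda>i. a (i + k)) G x" if "x \<in> {0..1}" for x
      using eq k that by simp
    ultimately show ?thesis
      by (metis (no_types, lifting) lipschitz_imp_absolutely_continuous_on lipschitz_on_transform)
  qed
  moreover have "(\<lambda>x. \<bar>nth_deriv m ?f x\<bar>\<^sup>2) absolutely_integrable_on {0..1}"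
    by (rule absolutely_integrable_spike[OF sq negligible_finite[OF \<open>finite S\<close>]]) (use eq in auto)
  ultimately show ?thesis by (auto simp: sobolev_W_def)
qed

section \<open>Minimisation over a finite-dimensional space\<close>

text \<open>Along the line \<open>s *\<^sub>R u + y\<close> the form is affine in \<open>s\<close>,
  and a nonnegative affine function is constant.\<close>

lemma psd_form_null:
  fixes B :: "'a::real_vector \<Rightarrow> 'a \<Rightarrow> real"
  assumes B: "bilinear B" and sym: "\<And>x y. B x y = B y x" and pos: "\<And>x. B x x \<ge> 0" and "B u u = 0"
  shows "B u y = 0"
proof (rule ccontr)
  assume nz: "B u y \<noteq> 0"
  \<comment> \<open>The parameter at which the affine function takes the value
    \<open>- 1\<close>.\<close>
  define s where "s = - (B y y + 1) / (2 * B u y)"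
  have "B (s *\<^sub>R u + y) (s *\<^sub>R u + y) = 2 * s * B u y + B y y"
    using assms(4) sym[of y u]
    by (simp add: bilinear_ladd[OF B] bilinear_radd[OF B] bilinear_lmul[OF B] bilinear_rmul[OF B])
  also have "\<dots> = - 1" using nz by (simp add: s_def field_simps)
  finally show False using pos[of "s *\<^sub>R u + y"] by simp
qed

text \<open>A new vector is reduced by the elements already found. If the remainder has length 0, it
  lies in the kernel by \<open>psd_form_null\<close> and is dropped; otherwise it is normalised and
  kept. Expansions therefore hold up to the kernel of \<open>B\<close>.\<close>

lemma gram_schmidt:
  fixes B :: "'a::real_vector \<Rightarrow> 'a \<Rightarrow> real"
  assumes B: "bilinear B" and sym: "\<And>x y. B x y = B y x" and pos: "\<And>x. B x x \<ge> 0" and "finite S"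
  shows "\<exists>E. finite E \<and> E \<subseteq> span S \<and> (\<forall>x\<in>span S. \<forall>y. B (x - (\<Sum>e\<in>E. B x e *\<^sub>R e)) y = 0)"
  using \<open>finite S\<close>
proof (induction S)
  case empty
  show ?case by (rule exI[of _ "{}"]) (simp add: bilinear_lzero[OF B])
next
  case (insert v S)
  note bil = bilinear_ladd[OF B] bilinear_radd[OF B] bilinear_lmul[OF B] bilinear_rmul[OF B]
    bilinear_lsub[OF B] bilinear_rsub[OF B]
  have lsum: "B (\<Sum>e\<in>F. c e *\<^sub>R e) y = (\<Sum>e\<in>F. c e * B e y)" if "finite F" for c F y
    using that by (induction F) (auto simp: bilinear_lzero[OF B] bil)
  obtain E where E: "finite E" "E \<subseteq> span S" "\<And>x y. x \<in> span S \<Longrightarrow> B (x - (\<Sum>e\<in>E. B x e *\<^sub>R e)) y = 0"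
    using insert.IH by blast
  have rep: "B x y = (\<Sum>e\<in>E. B x e * B e y)" if "x \<in> span S" for x y
    using E(3)[OF that, of y] lsum[OF E(1)] by (simp add: bil)
  define u where "u = v - (\<Sum>e\<in>E. B v e *\<^sub>R e)"
  have sub: "span S \<subseteq> span (insert v S)" by (rule span_mono) auto
  have uS: "u \<in> span (insert v S)"
    unfolding u_def using E(2) sub by (intro span_diff span_sum span_scale) (auto intro: span_base)
  have orth: "B x u = 0" if "x \<in> span S" for x
  proof -
    have "B u x = B v x - (\<Sum>e\<in>E. B v e * B e x)" by (simp add: u_def bil lsum[OF E(1)])
    also have "(\<Sum>e\<in>E. B v e * B e x) = B x v"
      unfolding rep[OF that, of v] by (rule sum.cong) (auto simp: sym mult.commute)
    finally show ?thesis using sym by simp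
  qed
  have dec: "\<exists>k s. s \<in> span S \<and> x = s + k *\<^sub>R v" if x: "x \<in> span (insert v S)" for x
  proof -
    obtain k where "x - k *\<^sub>R v \<in> span S" using x unfolding span_insert by blast
    then show ?thesis by (intro exI[of _ k] exI[of _ "x - k *\<^sub>R v"]) simp
  qed
  show ?case
  proof (cases "B u u = 0")
    case True
    note null = psd_form_null[OF B sym pos True]
    have "B (x - (\<Sum>e\<in>E. B x e *\<^sub>R e)) y = 0" if x: "x \<in> span (insert v S)" for x y
    proof -
      obtain k s where s: "s \<in> span S" "x = s + k *\<^sub>R v" using dec[OF x] by blast
      have "(\<Sum>e\<in>E. B x e * B e y) = (\<Sum>e\<in>E. B s e * B e y) + k * (\<Sum>e\<in>E. B v e * B e y)"
        by (simp add: s(2) bil algebra_simps sum.distrib sum_distrib_left)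
      moreover have "B v y = (\<Sum>e\<in>E. B v e * B e y)"
        using null[of y] by (simp add: u_def bil lsum[OF E(1)])
      ultimately show ?thesis using rep[OF s(1), of y] by (simp add: s(2) bil lsum[OF E(1)])
    qed
    then show ?thesis using E(1,2) sub by blast
  next
    case False
    then have upos: "B u u > 0" using pos[of u] by simp
    define w where "w = (1 / sqrt (B u u)) *\<^sub>R u"
    have wE: "w \<notin> E"
    proof
      assume "w \<in> E"
      then have "B w u = 0" using orth E(2) by blast
      then show False using upos by (simp add: w_def bil)
    qed
    have w: "B x w * B w y = B x u * B u y / B u u" for x y
      using upos by (simp add: w_def bil real_sqrt_mult_self field_simps)
    have "B (x - (\<Sum>e\<in>insert w E. B x e *\<^sub>R e)) y = 0" if x: "x \<in> span (insert v S)" for x y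
    proof -
      obtain k s where s: "s \<in> span S" "x = s + k *\<^sub>R v" using dec[OF x] by blast
      have 1: "(\<Sum>e\<in>E. B x e * B e y) = (\<Sum>e\<in>E. B s e * B e y) + k * (\<Sum>e\<in>E. B v e * B e y)"
        by (simp add: s(2) bil algebra_simps sum.distrib sum_distrib_left)
      have "v = u + (\<Sum>e\<in>E. B v e *\<^sub>R e)" by (simp add: u_def)
      then have "B v u = B u u + (\<Sum>e\<in>E. B v e * B e u)" by (metis bil(1) lsum[OF E(1)])
      also have "(\<Sum>e\<in>E. B v e * B e u) = 0" using orth E(2) by (intro sum.neutral) auto
      finally have "B x u = k * B u u" using orth[OF s(1)] by (simp add: s(2) bil)
      then have "B x w * B w y = k * B u y" using w[of x y] upos by simp
      moreover have "B u y = B v y - (\<Sum>e\<in>E. B v e * B e y)" by (simp add: u_def bil lsum[OF E(1)])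
      moreover have "B x y = B s y + k * B v y" by (simp add: s(2) bil)
      moreover have "B (x - (\<Sum>e\<in>insert w E. B x e *\<^sub>R e)) y
        = B x y - (B x w * B w y + (\<Sum>e\<in>E. B x e * B e y))"
        using E(1) lsum[of "insert w E" "B x" y] by (simp only: bil(5) finite_insert sum.insert[OF E(1) wE])
      ultimately show ?thesis using rep[OF s(1), of y] 1 by (simp add: right_diff_distrib)
    qed
    moreover have "w \<in> span (insert v S)" unfolding w_def by (rule span_scale[OF uS])
    ultimately show ?thesis using E(1,2) sub by (intro exI[of _ "insert w E"]) blast
  qed
qed

lemma finite_convergent_subsequence:
  fixes f :: "nat \<Rightarrow> 'a \<Rightarrow> real"
  assumes "finite E" "\<And>e. e \<in> E \<Longrightarrow> bounded (range (\<lambda>k. f k e))"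
  shows "\<exists>r :: nat \<Rightarrow> nat. strict_mono r \<and> (\<forall>e\<in>E. \<exists>l. (\<lambda>k. f (r k) e) \<longlonglongrightarrow> l)"
  using assms
proof (induction E)
  case empty
  show ?case by (rule exI[of _ id]) (simp add: strict_mono_def)
next
  case (insert e E)
  then obtain r :: "nat \<Rightarrow> nat" where r: "strict_mono r" "\<forall>e\<in>E. \<exists>l. (\<lambda>k. f (r k) e) \<longlonglongrightarrow> l" by auto
  have "bounded (range (\<lambda>k. f (r k) e))" by (rule bounded_subset[OF insert.prems[of e]]) auto
  then obtain l and s :: "nat \<Rightarrow> nat" where s: "strict_mono s" "((\<lambda>k. f (r k) e) \<circ> s) \<longlonglongrightarrow> l"
    using bounded_imp_convergent_subsequence by blast
  have "\<exists>l. (\<lambda>k. f ((r \<circ> s) k) e') \<longlonglongrightarrow> l" if e': "e' \<in> insert e E" for e'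
  proof (cases "e' = e")
    case True then show ?thesis using s(2) by (auto simp: o_def)
  next
    case False
    then obtain l' where "(\<lambda>k. f (r k) e') \<longlonglongrightarrow> l'" using r(2) e' by auto
    from LIMSEQ_subseq_LIMSEQ[OF this s(1)] show ?thesis by (auto simp: o_def)
  qed
  then show ?case using strict_mono_o[OF r(1) s(1)] by blast
qed

lemma lower_semicontinuous_on_eventually:
  assumes "lower_semicontinuous_on S g" "x \<in> S" "(f \<longlongrightarrow> x) F" "\<And>k. f k \<in> S" "c < g x"
  shows "\<forall>\<^sub>F k in F. c < g (f k)"
proof -
  have "\<forall>\<^sub>F y in at x within S. c < g y" using assms(1,2,5) by (auto simp: lower_semicontinuous_on_def)
  then have "\<forall>\<^sub>F y in nhds x. y \<noteq> x \<longrightarrow> y \<in> S \<longrightarrow> c < g y" by (simp add: eventually_at_filter)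
  then have "\<forall>\<^sub>F k in F. f k \<noteq> x \<longrightarrow> f k \<in> S \<longrightarrow> c < g (f k)"
    by (rule filterlim_iff[THEN iffD1, OF assms(3), rule_format])
  then show ?thesis by (rule eventually_mono) (use assms(4,5) in metis)
qed

text \<open>The direct method, with the coordinates \<open>A x e\<close> standing in for a topology
  on the vector space. They are bounded along a minimising sequence, while the vectors themselves
  may escape along the kernel of \<open>A\<close>.\<close>

lemma finite_dimensional_minimum:
  fixes Q :: "'a::real_vector \<Rightarrow> 'a \<Rightarrow> real" and z :: "nat \<Rightarrow> 'a \<Rightarrow> real"
    and Y :: "nat \<Rightarrow> real" and n :: nat
  assumes Q: "bilinear Q" "\<And>x y. Q x y = Q y x" "\<And>x. Q x x \<ge> 0" and z: "\<And>i. linear (z i)"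
    and S: "finite S" and "c > 0" "lam > 0"
    and lsc: "lower_semicontinuous_on {0..} g" and mono: "mono_on {0..} g" and unb: "\<not> bounded (g ` {0..})"
  defines "obj x \<equiv> c * (\<Sum>i=1..n. g \<bar>Y i - z i x\<bar>) + lam * Q x x"
  shows "\<exists>x\<in>span S. \<forall>y\<in>span S. obj x \<le> obj y"
proof -
  \<comment> \<open>The objective controls both summands: the loss bounds the data values and the
    penalty bounds \<open>Q\<close>. In the application \<open>A\<close> can still be degenerate,
    for instance on polynomials of degree below \<open>m\<close> that vanish at all knots.\<close>
  define A where "A x y = (\<Sum>i=1..n. z i x * z i y) + Q x y" for x y
  have bilA: "bilinear A"
    unfolding A_def bilinear_def using Q(1) z
    by (auto simp: bilinear_def linear_iff algebra_simps sum.distrib sum_distrib_left)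
  have symA: "A x y = A y x" for x y using Q(2)[of x y] by (simp add: A_def mult.commute)
  have posA: "A x x \<ge> 0" for x unfolding A_def by (intro add_nonneg_nonneg sum_nonneg Q(3)) simp
  obtain E where E: "finite E" "E \<subseteq> span S" "\<And>x y. x \<in> span S \<Longrightarrow> A (x - (\<Sum>e\<in>E. A x e *\<^sub>R e)) y = 0"
    using gram_schmidt[OF bilA symA posA S] by blast
  define P where "P w = (\<Sum>e\<in>E. w e *\<^sub>R e)" for w :: "'a \<Rightarrow> real"
  have zP: "z i (P w) = (\<Sum>e\<in>E. w e * z i e)" for i w
    unfolding P_def using z[of i] by (simp add: linear_sum linear_cmul)
  have QP: "Q (P w) (P w) = (\<Sum>e\<in>E. \<Sum>e'\<in>E. w e * w e' * Q e e')" for w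
    unfolding P_def bilinear_sum[OF Q(1)]
    by (simp add: sum.cartesian_product[symmetric] bilinear_lmul[OF Q(1)] bilinear_rmul[OF Q(1)] mult_ac)
  have PS: "P w \<in> span S" for w unfolding P_def using E(2) by (intro span_sum span_scale) auto
  \<comment> \<open>The difference is in the kernel of \<open>A\<close>, hence invisible to
    \<open>Q\<close> and to each \<open>z i\<close> in the sum.\<close>
  have obj_eq: "obj (P (A x)) = obj x" if x: "x \<in> span S" for x
  proof -
    define d where "d = x - P (A x)"
    have "A d d = 0" using E(3)[OF x] by (simp add: d_def P_def)
    then have "(\<Sum>i=1..n. z i d * z i d) = 0 \<and> Q d d = 0"
      unfolding A_def using Q(3)[of d] sum_nonneg[of "{1..n}" "\<lambda>i. z i d * z i d"] by simp
    then have 1: "\<forall>i\<in>{1..n}. z i d = 0" and 2: "Q d d = 0"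
      by (auto simp: sum_nonneg_eq_0_iff)
    have "x = P (A x) + d" by (simp add: d_def)
    then have "z i x = z i (P (A x)) + z i d" for i by (metis linear_add[OF z])
    then have "\<forall>i\<in>{1..n}. z i x = z i (P (A x))" using 1 by simp
    moreover have "Q x x = Q (P (A x)) (P (A x))"
    proof -
      have "Q d y = 0" "Q y d = 0" for y using psd_form_null[OF Q 2] Q(2) by metis+
      then have "Q (P (A x) + d) (P (A x) + d) = Q (P (A x)) (P (A x))"
        by (simp add: bilinear_ladd[OF Q(1)] bilinear_radd[OF Q(1)])
      then show ?thesis using \<open>x = P (A x) + d\<close> by simp
    qed
    ultimately show ?thesis by (simp add: obj_def)
  qed
  \<comment> \<open>Parseval's identity, which turns a bound on \<open>A x x\<close> into bounds on
    the coordinates.\<close>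
  have A_sum: "A x x = (\<Sum>e\<in>E. (A x e)\<^sup>2)" if x: "x \<in> span S" for x
  proof -
    have "A x x = A (P (A x)) x" using E(3)[OF x, of x] by (simp add: P_def bilinear_lsub[OF bilA])
    also have "\<dots> = (\<Sum>e\<in>E. A (A x e *\<^sub>R e) x)"
      unfolding P_def using bilA linear_sum[of "\<lambda>y. A y x"] by (simp add: bilinear_def)
    also have "\<dots> = (\<Sum>e\<in>E. A x e * A x e)"
      by (rule sum.cong[OF refl], subst bilinear_lmul[OF bilA], subst symA) simp
    finally show ?thesis by (simp add: power2_eq_square)
  qed
  have g0: "g 0 \<le> g r" if "r \<ge> 0" for r using mono that by (auto simp: mono_on_def)
  define L where "L = c * (real n * g 0)"
  have risk_ge: "L \<le> c * (\<Sum>i=1..n. g \<bar>Y i - z i x\<bar>)" for x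
    unfolding L_def using \<open>c > 0\<close> sum_mono[of "{1..n}" "\<lambda>i. g 0" "\<lambda>i. g \<bar>Y i - z i x\<bar>"] g0 by simp
  have lower: "L \<le> obj x" for x
    unfolding obj_def using risk_ge[of x] mult_nonneg_nonneg[OF less_imp_le[OF \<open>lam > 0\<close>] Q(3)[of x]] by linarith
  define J where "J = Inf (obj ` span S)"
  have bdd: "bdd_below (obj ` span S)" by (rule bdd_belowI2[of _ L]) (rule lower)
  have ne: "obj ` span S \<noteq> {}" using span_zero by blast
  have "\<exists>x. x \<in> span S \<and> obj x < J + 1 / real (Suc k)" for k
  proof -
    have "J < J + 1 / real (Suc k)" by simp
    then show ?thesis unfolding J_def cInf_less_iff[OF ne bdd] by auto
  qed
  then obtain X where X: "\<And>k. X k \<in> span S" "\<And>k. obj (X k) < J + 1 / real (Suc k)" by metis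
  have XJ: "obj (X k) \<le> J + 1" for k
  proof -
    have "1 / real (Suc k) \<le> 1" by simp
    then show ?thesis using X(2)[of k] by linarith
  qed
  \<comment> \<open>Beyond this \<open>r\<close> a single residual, with the other
    \<open>n - 1\<close> terms at their minimum \<open>g 0\<close>, already pushes the objective
    above \<open>J + 1\<close>.\<close>
  obtain r where r: "r \<ge> 0" "g r > (J + 1) / c - (real n - 1) * g 0"
  proof -
    have "\<exists>r\<ge>0. g r > K" for K
    proof (rule ccontr)
      assume "\<not> (\<exists>r\<ge>0. g r > K)"
      then have "\<forall>y\<in>g ` {0..}. \<bar>y\<bar> \<le> max \<bar>g 0\<bar> \<bar>K\<bar>" using g0 by fastforce
      then show False using unb unfolding bounded_real by blast
    qed
    then show thesis using that by blast
  qed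
  have zX: "\<bar>Y i - z i (X k)\<bar> \<le> r" if i: "i \<in> {1..n}" for i k
  proof (rule ccontr)
    assume "\<not> \<bar>Y i - z i (X k)\<bar> \<le> r"
    then have "g r \<le> g \<bar>Y i - z i (X k)\<bar>" using mono r(1) by (auto simp: mono_on_def)
    moreover have "(\<Sum>j\<in>{1..n} - {i}. g 0) \<le> (\<Sum>j\<in>{1..n} - {i}. g \<bar>Y j - z j (X k)\<bar>)"
      using g0 by (intro sum_mono) simp
    moreover have "(\<Sum>j\<in>{1..n} - {i}. g 0) = (real n - 1) * g 0" using i by (simp add: of_nat_diff)
    ultimately have "g r + (real n - 1) * g 0 \<le> (\<Sum>j=1..n. g \<bar>Y j - z j (X k)\<bar>)"
      using sum.remove[of "{1..n}" i "\<lambda>j. g \<bar>Y j - z j (X k)\<bar>"] i by simp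
    then have "(J + 1) / c < (\<Sum>j=1..n. g \<bar>Y j - z j (X k)\<bar>)" using r(2) by simp
    then have "J + 1 < c * (\<Sum>j=1..n. g \<bar>Y j - z j (X k)\<bar>)" using \<open>c > 0\<close> by (simp add: field_simps)
    also have "\<dots> \<le> obj (X k)" unfolding obj_def using Q(3) \<open>lam > 0\<close> by simp
    finally show False using XJ[of k] by simp
  qed
  \<comment> \<open>The first part comes from the residual bound \<open>r\<close>; the second bounds
    \<open>Q\<close>, because \<open>L\<close> is a lower bound of the loss.\<close>
  define M where "M = (\<Sum>i=1..n. (r + \<bar>Y i\<bar>)\<^sup>2) + (J + 1 - L) / lam"
  have AX: "A (X k) (X k) \<le> M" for k
    unfolding A_def M_def
  proof (intro add_mono sum_mono)
    show "z i (X k) * z i (X k) \<le> (r + \<bar>Y i\<bar>)\<^sup>2" if "i \<in> {1..n}" for i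
    proof -
      have "\<bar>z i (X k)\<bar> \<le> r + \<bar>Y i\<bar>" using zX[OF that, of k] by linarith
      from power_mono[OF this, of 2] show ?thesis by (simp add: power2_eq_square)
    qed
    have "lam * Q (X k) (X k) \<le> J + 1 - L" using XJ[of k] risk_ge[of "X k"] by (simp add: obj_def)
    then show "Q (X k) (X k) \<le> (J + 1 - L) / lam" using \<open>lam > 0\<close> by (simp add: field_simps)
  qed
  have "bounded (range (\<lambda>k. A (X k) e))" if e: "e \<in> E" for e
    unfolding bounded_real
  proof (intro exI[of _ "sqrt M"] ballI, clarify)
    fix k
    have "(A (X k) e)\<^sup>2 \<le> A (X k) (X k)"
      unfolding A_sum[OF X(1)] using E(1) e by (intro member_le_sum) auto
    then show "\<bar>A (X k) e\<bar> \<le> sqrt M" using AX[of k] by (intro real_le_rsqrt) simp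
  qed
  then obtain s :: "nat \<Rightarrow> nat" where s: "strict_mono s" "\<forall>e\<in>E. \<exists>l. (\<lambda>k. A (X (s k)) e) \<longlonglongrightarrow> l"
    using finite_convergent_subsequence[OF E(1), of "\<lambda>k. A (X k)"] by blast
  then obtain l where l: "\<And>e. e \<in> E \<Longrightarrow> (\<lambda>k. A (X (s k)) e) \<longlonglongrightarrow> l e" by metis
  \<comment> \<open>Replacing each vector by its expansion keeps the objective and makes data values
    and penalty converge.\<close>
  define V where "V k = P (A (X (s k)))" for k
  have objV: "obj (V k) < J + 1 / real (Suc k)" for k
  proof -
    have "1 / real (Suc (s k)) \<le> 1 / real (Suc k)" using seq_suble[OF s(1), of k] by (simp add: frac_le)
    then show ?thesis using obj_eq[OF X(1)] X(2)[of "s k"] by (simp add: V_def)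
  qed
  have zV: "(\<lambda>k. z i (V k)) \<longlonglongrightarrow> z i (P l)" for i
    unfolding V_def zP by (intro tendsto_intros l)
  have QV: "(\<lambda>k. Q (V k) (V k)) \<longlonglongrightarrow> Q (P l) (P l)"
    unfolding V_def QP by (intro tendsto_intros l)
  have "obj (P l) \<le> J + \<epsilon>" if "\<epsilon> > 0" for \<epsilon>
  proof -
    \<comment> \<open>Passing to the limit costs \<open>\<eta>\<close> in each of the
      \<open>n\<close> losses, weighted by \<open>c\<close>, and once in the penalty, weighted by
      \<open>lam\<close>; near-minimality of \<open>V k\<close> costs one more.\<close>
    define \<eta> where "\<eta> = \<epsilon> / (c * real n + lam + 1)"
    have pos: "c * real n + lam + 1 > 0" using \<open>c > 0\<close> \<open>lam > 0\<close> by (simp add: add_nonneg_pos)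
    then have "\<eta> > 0" using \<open>\<epsilon> > 0\<close> by (simp add: \<eta>_def)
    have "\<forall>\<^sub>F k in sequentially. g \<bar>Y i - z i (P l)\<bar> - \<eta> < g \<bar>Y i - z i (V k)\<bar>" for i
      by (rule lower_semicontinuous_on_eventually[OF lsc _ tendsto_rabs[OF tendsto_diff[OF tendsto_const zV]]])
        (use \<open>\<eta> > 0\<close> in auto)
    then have 1: "\<forall>\<^sub>F k in sequentially. \<forall>i\<in>{1..n}. g \<bar>Y i - z i (P l)\<bar> - \<eta> < g \<bar>Y i - z i (V k)\<bar>"
      by (simp add: eventually_ball_finite)
    have 2: "\<forall>\<^sub>F k in sequentially. Q (P l) (P l) - \<eta> < Q (V k) (V k)"
      using order_tendstoD(1)[OF QV] \<open>\<eta> > 0\<close> by simp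
    have 3: "\<forall>\<^sub>F k in sequentially. 1 / real (Suc k) < \<eta>"
      using order_tendstoD(2)[OF LIMSEQ_inverse_real_of_nat \<open>\<eta> > 0\<close>] by (simp add: inverse_eq_divide)
    obtain k where k: "\<forall>i\<in>{1..n}. g \<bar>Y i - z i (P l)\<bar> - \<eta> < g \<bar>Y i - z i (V k)\<bar>"
      "Q (P l) (P l) - \<eta> < Q (V k) (V k)" "1 / real (Suc k) < \<eta>"
      using eventually_happens[OF eventually_conj[OF 1 eventually_conj[OF 2 3]]] by auto
    have "(\<Sum>i=1..n. g \<bar>Y i - z i (P l)\<bar> - \<eta>) \<le> (\<Sum>i=1..n. g \<bar>Y i - z i (V k)\<bar>)"
      using k(1) by (intro sum_mono less_imp_le) auto
    then have "c * ((\<Sum>i=1..n. g \<bar>Y i - z i (P l)\<bar>) - real n * \<eta>) \<le> c * (\<Sum>i=1..n. g \<bar>Y i - z i (V k)\<bar>)"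
      using \<open>c > 0\<close> by (intro mult_left_mono) (auto simp: sum_subtractf)
    moreover have "lam * (Q (P l) (P l) - \<eta>) \<le> lam * Q (V k) (V k)"
      using k(2) \<open>lam > 0\<close> by (intro mult_left_mono) auto
    ultimately have "obj (P l) - (c * real n + lam) * \<eta> \<le> obj (V k)" by (simp add: obj_def algebra_simps)
    then have "obj (P l) \<le> J + (c * real n + lam + 1) * \<eta>" using objV[of k] k(3) by (simp add: algebra_simps)
    also have "\<dots> = J + \<epsilon>" using pos by (simp add: \<eta>_def)
    finally show ?thesis .
  qed
  then have "obj (P l) \<le> J" by (rule field_le_epsilon)
  moreover have "J \<le> obj y" if "y \<in> span S" for y
    unfolding J_def using bdd that by (intro cInf_lower) auto
  ultimately show ?thesis using PS by (meson order_trans)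
qed

section \<open>Square-integrable functions and splines\<close>

text \<open>Measurability of \<open>f\<close> is demanded separately, since it does not follow from
  that of its square.\<close>

definition square_integrable :: "(real \<Rightarrow> real) \<Rightarrow> bool" where
  "square_integrable f \<longleftrightarrow>
     f \<in> borel_measurable (lebesgue_on {0..1}) \<and> (\<lambda>x. (f x)\<^sup>2) absolutely_integrable_on {0..1}"

definition L2_inner :: "(real \<Rightarrow> real) \<Rightarrow> (real \<Rightarrow> real) \<Rightarrow> real" where
  "L2_inner f g = integral {0..1} (\<lambda>x. f x * g x)"

lemma square_integrable_mult:
  assumes "square_integrable f" "square_integrable g"
  shows "(\<lambda>x. f x * g x) integrable_on {0..1}"
proof (rule measurable_bounded_by_integrable_imp_absolutely_integrable[THEN set_lebesgue_integral_eq_integral(1)])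
  show "(\<lambda>x. f x * g x) \<in> borel_measurable (lebesgue_on {0..1})"
    using assms by (auto simp: square_integrable_def)
  show "(\<lambda>x. (f x)\<^sup>2 + (g x)\<^sup>2) integrable_on {0..1}"
    using assms by (intro integrable_add) (auto simp: square_integrable_def absolutely_integrable_on_def)
  show "norm (f x * g x) \<le> (f x)\<^sup>2 + (g x)\<^sup>2" for x
  proof -
    have "2 * (\<bar>f x\<bar> * \<bar>g x\<bar>) \<le> (f x)\<^sup>2 + (g x)\<^sup>2"
      using sum_squares_bound[of "\<bar>f x\<bar>" "\<bar>g x\<bar>"] by (simp add: mult.assoc)
    moreover have "0 \<le> \<bar>f x\<bar> * \<bar>g x\<bar>" by simp
    ultimately show ?thesis unfolding real_norm_def abs_mult by linarith
  qed
qed simp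

lemma square_integrable_scale:
  assumes "square_integrable f"
  shows "square_integrable (\<lambda>x. c * f x)"
  using assms set_integrable_mult_right[of "c\<^sup>2" lebesgue "{0..1}" "\<lambda>x. (f x)\<^sup>2"]
  by (auto simp: square_integrable_def power_mult_distrib)

lemma square_integrable_add:
  assumes "square_integrable f" "square_integrable g"
  shows "square_integrable (\<lambda>x. f x + g x)"
  unfolding square_integrable_def
proof
  show m: "(\<lambda>x. f x + g x) \<in> borel_measurable (lebesgue_on {0..1})"
    using assms by (auto simp: square_integrable_def)
  show "(\<lambda>x. (f x + g x)\<^sup>2) absolutely_integrable_on {0..1}"
  proof (rule measurable_bounded_by_integrable_imp_absolutely_integrable)
    show "(\<lambda>x. 2 * (f x)\<^sup>2 + 2 * (g x)\<^sup>2) integrable_on {0..1}"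
      using assms by (intro integrable_add integrable_on_mult_right) (auto simp: square_integrable_def absolutely_integrable_on_def)
    show "norm ((f x + g x)\<^sup>2) \<le> 2 * (f x)\<^sup>2 + 2 * (g x)\<^sup>2" for x
    proof -
      have "(f x + g x)\<^sup>2 \<le> 2 * (f x)\<^sup>2 + 2 * (g x)\<^sup>2"
        using zero_le_power2[of "f x - g x"] by (simp add: power2_sum power2_diff)
      then show ?thesis by simp
    qed
  qed (use m in auto)
qed

lemma square_integrable_sum:
  assumes "finite I" "\<And>i. i \<in> I \<Longrightarrow> square_integrable (f i)"
  shows "square_integrable (\<lambda>x. \<Sum>i\<in>I. f i x)"
  using assms
proof (induction I)
  case empty
  show ?case by (simp add: square_integrable_def)
next
  case (insert i I)
  then show ?case by (simp add: square_integrable_add)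
qed

lemma square_integrable_bounded:
  assumes "f \<in> borel_measurable (lebesgue_on {0..1})" "bounded (f ` {0..1})"
  shows "square_integrable f"
proof -
  obtain B where B: "\<And>x. x \<in> {0..1} \<Longrightarrow> \<bar>f x\<bar> \<le> B"
    using assms(2) unfolding bounded_iff by (metis imageI real_norm_def)
  have "(\<lambda>x. (f x)\<^sup>2) absolutely_integrable_on {0..1}"
  proof (rule measurable_bounded_by_integrable_imp_absolutely_integrable)
    show "(\<lambda>x. B\<^sup>2) integrable_on {0..1::real}" by (rule integrable_const_ivl)
    show "norm ((f x)\<^sup>2) \<le> B\<^sup>2" if "x \<in> {0..1}" for x
      using power_mono[OF B[OF that], of 2] by simp
  qed (use assms in auto)
  with assms(1) show ?thesis by (simp add: square_integrable_def)
qed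

section \<open>The inner product of square-integrable functions\<close>

lemma L2_inner_commute: "L2_inner f g = L2_inner g f"
  by (simp add: L2_inner_def mult.commute)

lemma L2_inner_nonneg: "L2_inner f f \<ge> 0"
proof (cases "(\<lambda>x. f x * f x) integrable_on {0..1}")
  case True
  then show ?thesis
    unfolding L2_inner_def by (rule Henstock_Kurzweil_Integration.integral_nonneg) simp
\<comment> \<open>Without integrability the integral defaults to 0.\<close>
qed (simp add: L2_inner_def not_integrable_integral)

lemma L2_inner_add_right:
  assumes "square_integrable f" "square_integrable g" "square_integrable h"
  shows "L2_inner f (\<lambda>x. g x + h x) = L2_inner f g + L2_inner f h"
  unfolding L2_inner_def
  by (subst Henstock_Kurzweil_Integration.integral_add[symmetric])
    (auto intro: square_integrable_mult assms simp: algebra_simps)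

lemma L2_inner_scale_right: "L2_inner f (\<lambda>x. c * g x) = c * L2_inner f g"
  unfolding L2_inner_def
  by (subst Henstock_Kurzweil_Integration.integral_mult_right[symmetric]) (simp add: mult_ac)

lemma L2_inner_add_left:
  assumes "square_integrable f" "square_integrable g" "square_integrable h"
  shows "L2_inner (\<lambda>x. g x + h x) f = L2_inner g f + L2_inner h f"
  using L2_inner_add_right[OF assms] by (simp only: L2_inner_commute[of f])

lemma L2_inner_scale_left: "L2_inner (\<lambda>x. c * g x) f = c * L2_inner g f"
  using L2_inner_scale_right[of f c g] by (simp only: L2_inner_commute[of f])

text \<open>The argument of \<open>psd_form_null\<close> is repeated because additivity of
  \<open>L2_inner\<close> is available for square-integrable functions and not on the whole type. In
  \<open>spline_dominates\<close> it makes the functional \<open>d\<close> vanish on null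
  vectors.\<close>

lemma L2_inner_null:
  assumes "square_integrable f" "square_integrable g" "L2_inner f f = 0"
  shows "L2_inner f g = 0"
proof (rule ccontr)
  assume nz: "L2_inner f g \<noteq> 0"
  define s where "s = - (L2_inner g g + 1) / (2 * L2_inner f g)"
  let ?h = "\<lambda>x. s * f x + g x"
  have sq: "square_integrable (\<lambda>x. s * f x)" by (rule square_integrable_scale[OF assms(1)])
  note h = square_integrable_add[OF sq assms(2)]
  have "L2_inner ?h ?h = s * L2_inner f ?h + L2_inner g ?h"
    using L2_inner_add_left[OF h sq assms(2)] by (simp add: L2_inner_scale_left)
  also have "L2_inner f ?h = L2_inner f g"
    using L2_inner_add_right[OF assms(1) sq assms(2)] assms(3) by (simp add: L2_inner_scale_right)
  also have "L2_inner g ?h = s * L2_inner f g + L2_inner g g"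
    using L2_inner_add_right[OF assms(2) sq assms(2)] by (simp add: L2_inner_scale_right L2_inner_commute[of g f])
  also have "s * L2_inner f g + (s * L2_inner f g + L2_inner g g) = - 1" using nz by (simp add: s_def field_simps)
  finally show False using L2_inner_nonneg[of ?h] by simp
qed

lemma L2_norm_square:
  assumes "(\<lambda>x. \<bar>f x\<bar>\<^sup>2) absolutely_integrable_on {0..1}"
  shows "(L2_norm f)\<^sup>2 = L2_inner f f"
proof -
  have "(LINT x:{0..1}|lebesgue. \<bar>f x\<bar>\<^sup>2) = L2_inner f f"
    using set_lebesgue_integral_eq_integral(2)[OF assms] by (simp add: L2_inner_def power2_eq_square)
  then show ?thesis by (simp add: L2_norm_def L2_inner_nonneg)
qed

text \<open>The fundamental theorem makes the top derivative integrable and hence measurable,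
  whereas \<open>sobolev_W\<close> speaks only of its square.\<close>

lemma sobolev_W_square_integrable:
  assumes f: "f \<in> sobolev_W m" and "m \<ge> 1"
  shows "square_integrable (nth_deriv m f)"
proof -
  obtain N where N: "negligible N" "\<And>k x. k < m \<Longrightarrow> x \<in> {0..1} - N \<Longrightarrow>
    (nth_deriv k f has_vector_derivative nth_deriv (Suc k) f x) (at x within {0..1})"
    using sobolev_has_derivatives[OF f] by metis
  have "absolutely_continuous_on {0..1} (nth_deriv (m - 1) f)"
    using f \<open>m \<ge> 1\<close> by (simp add: sobolev_W_def)
  from fundamental_theorem_absolutely_continuous[OF this _ N(1), of "nth_deriv m f"] N(2)[of "m - 1"] \<open>m \<ge> 1\<close>
  have "nth_deriv m f integrable_on {0..1}" by (auto simp: integrable_on_def)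
  then show ?thesis
    using f by (simp add: square_integrable_def sobolev_W_def integrable_imp_measurable)
qed

section \<open>Truncated powers and splines\<close>

lemma truncated_power_bounded: "bounded (truncated_power m t ` {0..1})"
proof -
  have "bounded ((\<lambda>u. (t - u) ^ (m - 1) / fact (m - 1)) ` {0..1::real})"
    by (intro compact_imp_bounded compact_continuous_image continuous_intros) auto
  then have "bounded (insert 0 ((\<lambda>u. (t - u) ^ (m - 1) / fact (m - 1)) ` {0..1::real}))" by simp
  then show ?thesis by (rule bounded_subset) (auto simp: truncated_power_def)
qed

lemma truncated_power_measurable: "truncated_power m t \<in> borel_measurable (lebesgue_on {0..1})"
proof -
  have "truncated_power m t \<in> borel_measurable borel" unfolding truncated_power_def by measurable
  then show ?thesis by (intro measurable_restrict_space1) (simp add: measurable_completion)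
qed

lemma square_integrable_truncated_power: "square_integrable (truncated_power m t)"
  by (intro square_integrable_bounded truncated_power_measurable truncated_power_bounded)

lemma continuous_truncated_power:
  assumes "u \<noteq> t"
  shows "continuous (at u within S) (truncated_power m t)"
proof (cases "u < t")
  case True
  have "continuous_on {..<t} (truncated_power m t)"
    by (subst continuous_on_cong[OF refl, where g = "\<lambda>u. (t - u) ^ (m - 1) / fact (m - 1)"])
      (auto simp: truncated_power_def intro!: continuous_intros)
  then show ?thesis using True by (simp add: continuous_on_eq_continuous_at continuous_at_imp_continuous_within)
next
  case False
  have "continuous_on {t<..} (truncated_power m t)"
    by (subst continuous_on_cong[OF refl, where g = "\<lambda>u. 0"]) (auto simp: truncated_power_def)
  then show ?thesis using False assms by (simp add: continuous_on_eq_continuous_at continuous_at_imp_continuous_within)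
qed

lemma lookup_scaleR: "Poly_Mapping.lookup (c *\<^sub>R x) i = c *\<^sub>R Poly_Mapping.lookup x i"
proof -
  have "finite {i. c *\<^sub>R Poly_Mapping.lookup x i \<noteq> 0}"
    by (rule finite_subset[OF _ finite_keys[of x]]) (auto simp: in_keys_iff)
  then show ?thesis by (simp add: scaleR_poly_mapping_def Abs_poly_mapping_inverse)
qed

text \<open>
  A spline is coded by its coefficients: the first \<open>m\<close> are the derivatives at \<open>0\<close>, and entry \<open>m + i\<close>
  is the weight of the truncated power at the knot \<open>t i\<close> in the \<open>m\<close>-th derivative.
\<close>

definition spline_top :: "nat \<Rightarrow> nat \<Rightarrow> (nat \<Rightarrow> real) \<Rightarrow> (nat \<Rightarrow>\<^sub>0 real) \<Rightarrow> real \<Rightarrow> real" where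
  "spline_top m n t x u = (\<Sum>i=1..n. Poly_Mapping.lookup x (m + i) * truncated_power m (t i) u)"

definition spline :: "nat \<Rightarrow> nat \<Rightarrow> (nat \<Rightarrow> real) \<Rightarrow> (nat \<Rightarrow>\<^sub>0 real) \<Rightarrow> real \<Rightarrow> real" where
  "spline m n t x = iterated_integral m (Poly_Mapping.lookup x) (spline_top m n t x)"

lemma square_integrable_spline_top: "square_integrable (spline_top m n t x)"
  unfolding spline_top_def
  by (intro square_integrable_sum square_integrable_scale square_integrable_truncated_power) simp

lemma spline_top_add: "spline_top m n t (x + y) = (\<lambda>u. spline_top m n t x u + spline_top m n t y u)"
  by (rule ext) (simp add: spline_top_def lookup_add distrib_right sum.distrib)

lemma spline_top_scaleR: "spline_top m n t (c *\<^sub>R x) = (\<lambda>u. c * spline_top m n t x u)"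
  by (rule ext) (simp add: spline_top_def lookup_scaleR sum_distrib_left mult_ac)

text \<open>The top derivative is continuous away from the finitely many knots, so the results on
  iterated integrals apply. The value formula is Taylor's formula for the spline itself and shows
  that values are linear in the coefficients.\<close>

lemma spline_properties:
  assumes "m \<ge> 1"
  shows "spline m n t x \<in> sobolev_W m"
    "(L2_norm (nth_deriv m (spline m n t x)))\<^sup>2 = L2_inner (spline_top m n t x) (spline_top m n t x)"
    "s \<in> {0..1} \<Longrightarrow> spline m n t x s =
      (\<Sum>k<m. Poly_Mapping.lookup x k * s ^ k / fact k) + L2_inner (truncated_power m s) (spline_top m n t x)"
proof -
  let ?G = "spline_top m n t x" and ?f = "spline m n t x"
  define S where "S = t ` {1..n}"
  have sq: "square_integrable ?G" by (rule square_integrable_spline_top)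
  \<comment> \<open>The factor 1 turns integrability of products into that of
    \<open>?G\<close>.\<close>
  have "square_integrable (\<lambda>u. 1)" by (simp add: square_integrable_def)
  from square_integrable_mult[OF sq this] have int: "?G integrable_on {0..1}" by simp
  have "bounded ((\<lambda>u. \<Sum>i\<in>I. Poly_Mapping.lookup x (m + i) * truncated_power m (t i) u) ` {0..1})" if "finite I" for I
    using that
  proof (induction I)
    case (insert i I)
    have "bounded ((\<lambda>u. Poly_Mapping.lookup x (m + i) * truncated_power m (t i) u) ` {0..1})"
      using bounded_scaleR_comp[OF truncated_power_bounded[of m "t i"], of "Poly_Mapping.lookup x (m + i)"] by simp
    from bounded_plus_comp[OF this insert.IH] show ?case using insert by simp
  qed (auto simp: image_constant_conv)
  then have bdd: "bounded (?G ` {0..1})" unfolding spline_top_def by simp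
  have cont: "\<forall>u\<in>{0..1} - S. continuous (at u within {0..1}) ?G"
    unfolding spline_top_def by (intro ballI continuous_intros continuous_truncated_power) (auto simp: S_def)
  have "finite S" by (simp add: S_def)
  show W: "?f \<in> sobolev_W m"
    unfolding spline_def
    by (rule iterated_integral_in_sobolev_W[OF int bdd cont \<open>finite S\<close>]) (use sq in \<open>simp add: square_integrable_def\<close>)
  have top: "nth_deriv m ?f u = ?G u" if "u \<in> {0..1} - S" for u
    unfolding spline_def using nth_deriv_iterated_integral[OF int bdd cont, of m m u "Poly_Mapping.lookup x"] that by simp
  have neg: "negligible S" using \<open>finite S\<close> by (rule negligible_finite)
  have "(L2_norm (nth_deriv m ?f))\<^sup>2 = L2_inner (nth_deriv m ?f) (nth_deriv m ?f)"
    using W by (intro L2_norm_square) (simp add: sobolev_W_def)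
  also have "\<dots> = L2_inner ?G ?G"
    unfolding L2_inner_def by (rule integral_spike[OF neg]) (simp add: top)
  finally show "(L2_norm (nth_deriv m ?f))\<^sup>2 = L2_inner ?G ?G" .
  assume s: "s \<in> {0..1}"
  have "nth_deriv k ?f 0 = Poly_Mapping.lookup x k" if "k < m" for k
    unfolding spline_def
    using nth_deriv_iterated_integral[OF int bdd cont, of k m 0 "Poly_Mapping.lookup x"] that iterated_integral_at_0[of "m - k"] by simp
  then have "?f s - (\<Sum>k<m. Poly_Mapping.lookup x k * s ^ k / fact k)
    = integral {0..1} (\<lambda>u. truncated_power m s u * nth_deriv m ?f u)"
    using integral_unique[OF sobolev_taylor[OF W assms s]] by simp
  also have "\<dots> = L2_inner (truncated_power m s) ?G"
    unfolding L2_inner_def by (rule integral_spike[OF neg]) (simp add: top)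
  finally show "?f s = (\<Sum>k<m. Poly_Mapping.lookup x k * s ^ k / fact k) + L2_inner (truncated_power m s) ?G" by simp
qed

lemma bilinear_spline_form:
  "bilinear (\<lambda>x y. L2_inner (spline_top m n t x) (spline_top m n t y))"
proof -
  have "linear (\<lambda>y. L2_inner (spline_top m n t x) (spline_top m n t y))" for x
    by (rule linearI)
      (simp_all add: spline_top_add spline_top_scaleR L2_inner_add_right L2_inner_scale_right square_integrable_spline_top)
  then show ?thesis
    unfolding bilinear_def by (subst (2) L2_inner_commute) blast
qed

text \<open>The projection takes place on coefficients: \<open>?D\<close> acts on them by the
  functional \<open>d\<close>, and projecting it means representing \<open>d\<close> by some
  \<open>w\<close> with respect to the semidefinite form \<open>B\<close>. By Taylor's formula,
  \<open>d\<close> at the unit vector of knot \<open>i\<close> is the remainder of \<open>h\<close>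
  at \<open>t i\<close>, so such a \<open>w\<close> preserves the values.\<close>

lemma spline_dominates:
  assumes "m \<ge> 1" and h: "h \<in> sobolev_W m" and t: "\<And>i. i \<in> {1..n} \<Longrightarrow> t i \<in> {0..1}"
  shows "\<exists>x\<in>span ((\<lambda>j. Poly_Mapping.single j 1) ` {..m + n}). (\<forall>i\<in>{1..n}. spline m n t x (t i) = h (t i)) \<and>
    (L2_norm (nth_deriv m (spline m n t x)))\<^sup>2 \<le> (L2_norm (nth_deriv m h))\<^sup>2"
proof -
  let ?G = "spline_top m n t" and ?D = "nth_deriv m h"
  let ?e = "\<lambda>j. Poly_Mapping.single j (1::real)"
  define B where "B x y = L2_inner (?G x) (?G y)" for x y
  define T where "T = (\<lambda>i. ?e (m + i)) ` {1..n}"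
  have bil: "bilinear B" unfolding B_def by (rule bilinear_spline_form)
  have sym: "B x y = B y x" for x y by (simp add: B_def L2_inner_commute)
  have pos: "B x x \<ge> 0" for x by (simp add: B_def L2_inner_nonneg)
  obtain E where E: "finite E" "E \<subseteq> span T" "\<And>x y. x \<in> span T \<Longrightarrow> B (x - (\<Sum>e\<in>E. B x e *\<^sub>R e)) y = 0"
    using gram_schmidt[OF bil sym pos, of T] by (auto simp: T_def)
  have D: "square_integrable ?D" by (rule sobolev_W_square_integrable[OF h \<open>m \<ge> 1\<close>])
  note G = square_integrable_spline_top[of m n t]
  define d where "d x = L2_inner ?D (?G x)" for x
  have lin_d: "linear d"
    unfolding d_def by (rule linearI) (simp_all add: spline_top_add spline_top_scaleR L2_inner_add_right L2_inner_scale_right D G)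
  define w where "w = (\<Sum>e\<in>E. d e *\<^sub>R e)"
  have wT: "w \<in> span T" unfolding w_def using E(2) by (intro span_sum span_scale) auto
  have dB: "d x = B x w" if x: "x \<in> span T" for x
  proof -
    let ?u = "x - (\<Sum>e\<in>E. B x e *\<^sub>R e)"
    have "L2_inner (?G ?u) (?G ?u) = 0" using E(3)[OF x, of ?u] by (simp add: B_def)
    \<comment> \<open>A functional that is represented by \<open>B\<close> has to vanish on the
      kernel of \<open>B\<close>.\<close>
    from L2_inner_null[OF G D this] have "d ?u = 0" by (simp add: d_def L2_inner_commute)
    then have "d x = (\<Sum>e\<in>E. B x e * d e)"
      using lin_d by (simp add: linear_diff linear_sum linear_cmul)
    also have "\<dots> = B x w"
    proof -
      have "linear (B x)" using bil by (simp add: bilinear_def)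
      then show ?thesis unfolding w_def by (simp add: linear_sum linear_cmul mult.commute)
    qed
    finally show ?thesis .
  qed
  \<comment> \<open>Bessel's inequality: the squared norm of \<open>?D\<close> minus
    \<open>?G w\<close> is nonnegative, and \<open>d w = B w w\<close>.\<close>
  have "B w w \<le> L2_inner ?D ?D"
  proof -
    let ?r = "\<lambda>u. ?D u + (- 1) * ?G w u"
    have sq: "square_integrable (\<lambda>u. (- 1) * ?G w u)" by (rule square_integrable_scale[OF G])
    note r = square_integrable_add[OF D sq]
    have "L2_inner ?r ?r = L2_inner ?D ?r - L2_inner (?G w) ?r"
      using L2_inner_add_left[OF r D sq] L2_inner_scale_left[of "-1" "?G w" ?r] by simp
    also have "L2_inner ?D ?r = L2_inner ?D ?D - d w"
      using L2_inner_add_right[OF D D sq] L2_inner_scale_right[of ?D "-1" "?G w"] by (simp add: d_def)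
    also have "L2_inner (?G w) ?r = d w - B w w"
      using L2_inner_add_right[OF G[of w] D sq] L2_inner_scale_right[of "?G w" "-1" "?G w"]
      by (simp add: d_def B_def L2_inner_commute[of "?G w" ?D])
    finally show ?thesis using L2_inner_nonneg[of ?r] dB[OF wT] by simp
  qed
  \<comment> \<open>The polynomial part restores the derivatives of \<open>h\<close> at 0;
    \<open>p\<close> and \<open>w\<close> occupy disjoint sets of entries.\<close>
  define p where "p = (\<Sum>k<m. nth_deriv k h 0 *\<^sub>R ?e k)"
  define x where "x = p + w"
  have lookup_sum: "Poly_Mapping.lookup (\<Sum>k\<in>K. f k) j = (\<Sum>k\<in>K. Poly_Mapping.lookup (f k) j)" if "finite K" for K :: "nat set" and f :: "nat \<Rightarrow> nat \<Rightarrow>\<^sub>0 real" and j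
    using that by (induction K) (auto simp: lookup_add)
  have p_low: "Poly_Mapping.lookup p k = nth_deriv k h 0" if "k < m" for k
    unfolding p_def using that by (simp add: lookup_sum lookup_scaleR lookup_single when_def if_distrib cong: if_cong)
  have p_high: "Poly_Mapping.lookup p (m + i) = 0" for i
    unfolding p_def by (simp add: lookup_sum lookup_scaleR lookup_single when_def)
  have w_low: "Poly_Mapping.lookup w k = 0" if "k < m" for k
    using wT
  proof (induction rule: span_induct)
    show "subspace {y. Poly_Mapping.lookup y k = 0}" by (auto simp: subspace_def lookup_add lookup_scaleR)
    show "Poly_Mapping.lookup y k = 0" if "y \<in> T" for y using that \<open>k < m\<close> by (auto simp: T_def lookup_single when_def)
  qed
  have Gx: "?G x = ?G w" by (rule ext) (simp add: spline_top_def x_def lookup_add p_high)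
  have "spline m n t x (t i) = h (t i)" if i: "i \<in> {1..n}" for i
  proof -
    have "?G (?e (m + i)) = truncated_power m (t i)"
      by (rule ext) (use i in \<open>simp add: spline_top_def lookup_single when_def if_distrib if_distribR cong: if_cong\<close>)
    moreover have "?e (m + i) \<in> span T" using i by (auto simp: T_def intro: span_base)
    ultimately have "L2_inner (truncated_power m (t i)) (?G x) = L2_inner ?D (truncated_power m (t i))"
      using dB[of "?e (m + i)"] by (simp add: d_def B_def Gx)
    also have "\<dots> = h (t i) - (\<Sum>k<m. nth_deriv k h 0 * t i ^ k / fact k)"
      using integral_unique[OF sobolev_taylor[OF h \<open>m \<ge> 1\<close> t[OF i]]] by (simp add: L2_inner_def mult.commute)
    finally have "L2_inner (truncated_power m (t i)) (?G x) = h (t i) - (\<Sum>k<m. nth_deriv k h 0 * t i ^ k / fact k)" .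
    moreover have "Poly_Mapping.lookup x k = nth_deriv k h 0" if "k < m" for k
      using p_low[OF that] w_low[OF that] by (simp add: x_def lookup_add)
    ultimately show ?thesis using spline_properties(3)[OF \<open>m \<ge> 1\<close> t[OF i]] by simp
  qed
  moreover have "(L2_norm (nth_deriv m (spline m n t x)))\<^sup>2 \<le> (L2_norm ?D)\<^sup>2"
    using \<open>B w w \<le> L2_inner ?D ?D\<close> spline_properties(2)[OF \<open>m \<ge> 1\<close>, of n t x] L2_norm_square[of ?D] h
    by (simp add: Gx B_def sobolev_W_def)
  moreover have "x \<in> span (?e ` {..m + n})"
    unfolding x_def
  proof (rule span_add)
    show "p \<in> span (?e ` {..m + n})" unfolding p_def by (intro span_sum span_scale span_base) auto
    have "T \<subseteq> ?e ` {..m + n}" by (auto simp: T_def)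
    then show "w \<in> span (?e ` {..m + n})" using span_mono wT by blast
  qed
  ultimately show ?thesis by blast
qed

theorem theorem1:
  fixes m n :: nat and t Y :: "nat \<Rightarrow> real" and lam :: real and \<rho> g :: "real \<Rightarrow> real"
  assumes "m \<ge> 1" and "n \<ge> m"
    and "\<And>i. i \<in> {1..n} \<Longrightarrow> t i \<in> {0..1}"
    and "lam > 0"
    and "\<And>x. \<rho> x = g \<bar>x\<bar>"
    and "lower_semicontinuous_on {0..} g"
    and "mono_on {0..} g"
    and "\<not> bounded (g ` {0..})"
  shows "\<exists>f\<in>sobolev_W m. \<forall>h\<in>sobolev_W m.
           penalized_risk m n t Y lam \<rho> f \<le> penalized_risk m n t Y lam \<rho> h"
proof -
  \<comment> \<open>Knots are numbered from 1, so their weights sit at the indices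
    \<open>m + 1\<close> to \<open>m + n\<close>.\<close>
  let ?V = "span ((\<lambda>j. Poly_Mapping.single j (1::real)) ` {..m + n})"
  define Q where "Q x y = L2_inner (spline_top m n t x) (spline_top m n t y)" for x y
  \<comment> \<open>The right-hand side of Taylor's formula is linear in the coefficients for every
    \<open>i\<close>, even when \<open>t i\<close> lies outside \<open>[0, 1]\<close>.\<close>
  define z where "z i x = (\<Sum>k<m. Poly_Mapping.lookup x k * t i ^ k / fact k) + L2_inner (truncated_power m (t i)) (spline_top m n t x)"
    for i x
  have lin: "linear (z i)" for i
    unfolding z_def
    by (rule linearI)
      (simp_all add: lookup_add lookup_scaleR add_divide_distrib distrib_right sum.distrib spline_top_add spline_top_scaleR
        L2_inner_add_right L2_inner_scale_right square_integrable_spline_top square_integrable_truncated_power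
        sum_distrib_left distrib_left mult_ac)
  have risk: "penalized_risk m n t Y lam \<rho> (spline m n t x) =
    1 / real n * (\<Sum>i=1..n. g \<bar>Y i - z i x\<bar>) + lam * Q x x" for x
    unfolding penalized_risk_def spline_properties(2)[OF \<open>m \<ge> 1\<close>] Q_def
    using spline_properties(3)[OF \<open>m \<ge> 1\<close> assms(3)] by (simp add: assms(5) z_def)
  have bil: "bilinear Q" unfolding Q_def by (rule bilinear_spline_form)
  \<comment> \<open>From \<open>1 \<le> m\<close> and \<open>m \<le> n\<close> the weight
    \<open>1 / real n\<close> is positive.\<close>
  have "\<exists>x\<in>?V. \<forall>y\<in>?V. 1 / real n * (\<Sum>i=1..n. g \<bar>Y i - z i x\<bar>) + lam * Q x x
      \<le> 1 / real n * (\<Sum>i=1..n. g \<bar>Y i - z i y\<bar>) + lam * Q y y"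
    by (rule finite_dimensional_minimum[OF bil]) (use lin assms in \<open>auto simp: Q_def L2_inner_commute L2_inner_nonneg\<close>)
  then obtain x where min: "\<forall>y\<in>?V. 1 / real n * (\<Sum>i=1..n. g \<bar>Y i - z i x\<bar>) + lam * Q x x
      \<le> 1 / real n * (\<Sum>i=1..n. g \<bar>Y i - z i y\<bar>) + lam * Q y y" by blast
  show ?thesis
  proof (intro bexI ballI)
    show "spline m n t x \<in> sobolev_W m" by (rule spline_properties(1)[OF \<open>m \<ge> 1\<close>])
    fix h assume h: "h \<in> sobolev_W m"
    obtain y where y: "y \<in> ?V" "\<forall>i\<in>{1..n}. spline m n t y (t i) = h (t i)"
      "(L2_norm (nth_deriv m (spline m n t y)))\<^sup>2 \<le> (L2_norm (nth_deriv m h))\<^sup>2"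
      using spline_dominates[where n = n and t = t, OF \<open>m \<ge> 1\<close> h] assms(3) by blast
    have "penalized_risk m n t Y lam \<rho> (spline m n t x) \<le> penalized_risk m n t Y lam \<rho> (spline m n t y)"
      unfolding risk using min y(1) by blast
    also have "\<dots> \<le> penalized_risk m n t Y lam \<rho> h"
      unfolding penalized_risk_def using y(2,3) \<open>lam > 0\<close> by (intro add_mono mult_left_mono) auto
    finally show "penalized_risk m n t Y lam \<rho> (spline m n t x) \<le> penalized_risk m n t Y lam \<rho> h" .
  qed
qed

end
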